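(* Let $r\in\mathbb R$ be such that $M_U(r)<\infty$, and put $\alpha(r)=\frac{1-M_U(r)}{\delta}$. Assume $M_Y(-\alpha(r))<\infty$ and $\mathbb E[Y\exp(-\alpha(r)Y)]<\infty$. Put $\theta(r)=-cr+\rho\,(M_Y(-\alpha(r))-1)$, $\beta=\exp(ru+\alpha(r)\lambda_0)$ and $$h(x,\lambda,t)=\beta\exp(-\theta(r)t-\alpha(r)\lambda-rx).$$ Then the process $M^r_t:=h(X_t,\lambda_t,t)$, $t\ge0$, is a martingale with respect to $(\mathcal F_t)_{t\ge0}$ under $\mathbb P_{(u,\lambda_0)}$, with expectation $1$.
   Context: Model. Fix constants $\rho>0$, $\delta>0$, $c>0$, an initial capital $u\ge 0$ and an initial intensity $\lambda_0>0$. Let $N^\lambda$ be a Poisson process with intensity $\rho$ and jump times $T^\lambda_1<T^\lambda_2<\dots$, and let $(Y_i)_{i\ge1}$ be i.i.d. copies of a positive random variable $Y$ with distribution function $F_Y$, independent of $N^\lambda$. The Markovian shot-noise process is $\lambda_t=\lambda_0e^{-\delta t}+\sum_{i=1}^{N^\lambda_t}Y_ie^{-\delta(t-T^\lambda_i)}$. Let $N$ be a Cox process with intensity $\lambda$ (conditionally on the path of $\lambda$, $N$ is an inhomogeneous Poisson process with intensity function $t\mapsto\lambda_t$), and let $(U_i)_{i\ge1}$ be i.i.d. copies of a positive random variable $U$ with continuous distribution function $F_U$, independent of $(\lambda,N)$. The surplus process is $X_t=u+ct-\sum_{i=1}^{N_t}U_i$. $\mathbb P_{(u,\lambda_0)}$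 denotes the probability for initial capital $u$ and initial intensity $\lambda_0$. $\mathcal F_t=\mathcal F^X_t\vee\mathcal F^\lambda_t$, where $\mathcal F^Z_t$ is the complete, right-continuous natural filtration of $Z$. $M_U(s)=\mathbb E[e^{sU}]$ and $M_Y(s)=\mathbb E[e^{sY}]$. Standing assumption (net profit condition): $c>\frac{\rho}{\delta}\mathbb E[U]\mathbb E[Y]$. *)

theory Defs
  imports "HOL-Probability.Probability"
begin

section \<open>Processes, filtrations, martingales\<close>

text \<open>Processes are indexed by \<^typ>\<open>real\<close>, but only their values at times \<open>t \<ge> 0\<close> are ever used.\<close>

definition generated_sigma ::
    "'a measure \<Rightarrow> real set \<Rightarrow> (real \<Rightarrow> 'a \<Rightarrow> real) \<Rightarrow> 'a measure" where
  "generated_sigma M I Z =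
     sigma (space M) {Z s -` A \<inter> space M | s A. s \<in> I \<and> A \<in> sets borel}"

text \<open>The complete, right-continuous natural filtration of \<open>Z\<close>. The null sets added are those of the
  completion of \<open>M\<close>, so that subsets of null events are included even when \<open>M\<close> is not complete.\<close>

definition augmented_filtration ::
    "'a measure \<Rightarrow> (real \<Rightarrow> 'a \<Rightarrow> real) \<Rightarrow> real \<Rightarrow> 'a measure" where
  "augmented_filtration M Z t =
     sigma (space M)
       (\<Inter>v\<in>{t<..}. sigma_sets (space M)
          (sets (generated_sigma M {0..v} Z) \<union> null_sets (completion M)))"

definition join_filtration ::
    "'a measure \<Rightarrow> (real \<Rightarrow> 'a measure) \<Rightarrow> (real \<Rightarrow> 'a measure) \<Rightarrow> real \<Rightarrow> 'a measure" where
  "join_filtration M F G t = sigma (space M) (sets (F t) \<union> sets (G t))"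

definition martingale ::
    "'a measure \<Rightarrow> (real \<Rightarrow> 'a measure) \<Rightarrow> (real \<Rightarrow> 'a \<Rightarrow> real) \<Rightarrow> bool" where
  "martingale M F Z \<longleftrightarrow>
     (\<forall>t\<ge>0. subalgebra M (F t)) \<and>
     (\<forall>s t. 0 \<le> s \<longrightarrow> s \<le> t \<longrightarrow> sets (F s) \<subseteq> sets (F t)) \<and>
     (\<forall>t\<ge>0. Z t \<in> borel_measurable (F t)) \<and>
     (\<forall>t\<ge>0. integrable M (Z t)) \<and>
     (\<forall>s t. 0 \<le> s \<longrightarrow> s \<le> t \<longrightarrow> (AE \<omega> in M. real_cond_exp M (F s) (Z t) \<omega> = Z s \<omega>))"

section \<open>Poisson and Cox processes\<close>

text \<open>Unit jump size is not required here: it holds almost surely for the Poisson and Cox processes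
  below, by their increment laws.\<close>

definition counting_process :: "'a measure \<Rightarrow> (real \<Rightarrow> 'a \<Rightarrow> nat) \<Rightarrow> bool" where
  "counting_process M N \<longleftrightarrow>
     (\<forall>t\<ge>0. N t \<in> measurable M (count_space UNIV)) \<and>
     (\<forall>\<omega>\<in>space M.
        N 0 \<omega> = 0 \<and>
        (\<forall>s t. 0 \<le> s \<longrightarrow> s \<le> t \<longrightarrow> N s \<omega> \<le> N t \<omega>) \<and>
        (\<forall>t\<ge>0. continuous (at_right t) (\<lambda>s. N s \<omega>)))"

definition jump_time :: "(real \<Rightarrow> 'a \<Rightarrow> nat) \<Rightarrow> nat \<Rightarrow> 'a \<Rightarrow> real" where
  "jump_time N i \<omega> = Inf {t. 0 \<le> t \<and> i \<le> N t \<omega>}"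

text \<open>Subtraction of increments is on \<^typ>\<open>nat\<close>; it does not truncate, as the paths are monotone.
  The library's \<^const>\<open>poisson_pmf\<close> is only meaningful for a positive rate, hence \<open>s < t\<close>.\<close>

definition poisson_process :: "'a measure \<Rightarrow> real \<Rightarrow> (real \<Rightarrow> 'a \<Rightarrow> nat) \<Rightarrow> bool" where
  "poisson_process M \<rho> N \<longleftrightarrow>
     counting_process M N \<and>
     (\<forall>n (\<tau> :: nat \<Rightarrow> real). 0 \<le> \<tau> 0 \<longrightarrow> (\<forall>i<n. \<tau> i \<le> \<tau> (Suc i)) \<longrightarrow>
        prob_space.indep_vars M (\<lambda>_. count_space UNIV)
          (\<lambda>i \<omega>. N (\<tau> (Suc i)) \<omega> - N (\<tau> i) \<omega>) {..<n}) \<and>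
     (\<forall>s t. 0 \<le> s \<longrightarrow> s < t \<longrightarrow>
        distr M (count_space UNIV) (\<lambda>\<omega>. N t \<omega> - N s \<omega>) =
          measure_pmf (poisson_pmf (\<rho> * (t - s))))"

text \<open>Conditionally on the whole path \<open>(L s)\<close>, \<open>s \<ge> 0\<close>, the increments of \<open>N\<close> over consecutive intervals
  are independent and Poisson distributed with means the integrals of \<open>L\<close>. The Poisson weights are
  written out because the mean may be \<open>0\<close> (e.g. on an empty interval).\<close>

definition cox_process ::
    "'a measure \<Rightarrow> (real \<Rightarrow> 'a \<Rightarrow> real) \<Rightarrow> (real \<Rightarrow> 'a \<Rightarrow> nat) \<Rightarrow> bool" where
  "cox_process M L N \<longleftrightarrow>
     counting_process M N \<and>
     (\<forall>n (\<tau> :: nat \<Rightarrow> real) (k :: nat \<Rightarrow> nat).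
        0 \<le> \<tau> 0 \<longrightarrow> (\<forall>i<n. \<tau> i \<le> \<tau> (Suc i)) \<longrightarrow>
        (AE \<omega> in M.
           real_cond_exp M (generated_sigma M {0..} L)
             (indicator {\<omega>' \<in> space M. \<forall>i<n. N (\<tau> (Suc i)) \<omega>' - N (\<tau> i) \<omega>' = k i}) \<omega> =
           (\<Prod>i<n. let m = (LBINT v:{\<tau> i..\<tau> (Suc i)}. L v \<omega>)
                   in m ^ k i / fact (k i) * exp (- m))))"

section \<open>The risk model with Markovian shot-noise intensity\<close>

text \<open>Sequences are indexed from \<open>1\<close>; \<open>\<nu>\<close> is the common law.\<close>

definition iid_seq :: "'a measure \<Rightarrow> real measure \<Rightarrow> (nat \<Rightarrow> 'a \<Rightarrow> real) \<Rightarrow> bool" where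
  "iid_seq M \<nu> Z \<longleftrightarrow>
     prob_space.indep_vars M (\<lambda>_. borel) Z {1..} \<and> (\<forall>i\<ge>1. distr M borel (Z i) = \<nu>)"

text \<open>The library's \<^const>\<open>prob_space.indep_var\<close> requires both variables to take values in the same type.\<close>

definition indep_rv ::
    "'a measure \<Rightarrow> 'b measure \<Rightarrow> ('a \<Rightarrow> 'b) \<Rightarrow> 'c measure \<Rightarrow> ('a \<Rightarrow> 'c) \<Rightarrow> bool" where
  "indep_rv M S V T W \<longleftrightarrow>
     V \<in> measurable M S \<and> W \<in> measurable M T \<and>
     prob_space.indep_set M (sets (vimage_algebra (space M) V S)) (sets (vimage_algebra (space M) W T))"

definition shot_noise ::
    "real \<Rightarrow> real \<Rightarrow> (real \<Rightarrow> 'a \<Rightarrow> nat) \<Rightarrow> (nat \<Rightarrow> 'a \<Rightarrow> real) \<Rightarrow> real \<Rightarrow> 'a \<Rightarrow> real" where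
  "shot_noise \<delta> lam0 NL Y t \<omega> =
     lam0 * exp (- \<delta> * t) + (\<Sum>i=1..NL t \<omega>. Y i \<omega> * exp (- \<delta> * (t - jump_time NL i \<omega>)))"

definition surplus ::
    "real \<Rightarrow> real \<Rightarrow> (real \<Rightarrow> 'a \<Rightarrow> nat) \<Rightarrow> (nat \<Rightarrow> 'a \<Rightarrow> real) \<Rightarrow> real \<Rightarrow> 'a \<Rightarrow> real" where
  "surplus c u N U t \<omega> = u + c * t - (\<Sum>i=1..N t \<omega>. U i \<omega>)"

text \<open>The value of \<open>mgf\<close> is only meaningful where the integrand is integrable.\<close>

definition mgf :: "real measure \<Rightarrow> real \<Rightarrow> real" where
  "mgf \<nu> s = (\<integral>x. exp (s * x) \<partial>\<nu>)"

text \<open>\<open>NL\<close> is the Poisson process driving the intensity, \<open>\<nu>Y\<close> and \<open>\<nu>U\<close> are the laws of \<open>Y\<close> and \<open>U\<close>.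
  The integrability of both is part of the net profit condition: with an infinite mean its right-hand
  side would be infinite.\<close>

locale shot_noise_risk_model = prob_space M
  for M :: "'a measure" +
  fixes \<rho> \<delta> c u lam0 :: real
    and NL :: "real \<Rightarrow> 'a \<Rightarrow> nat" and Y :: "nat \<Rightarrow> 'a \<Rightarrow> real" and \<nu>Y :: "real measure"
    and N :: "real \<Rightarrow> 'a \<Rightarrow> nat" and U :: "nat \<Rightarrow> 'a \<Rightarrow> real" and \<nu>U :: "real measure"
  assumes rho_pos: "\<rho> > 0" and delta_pos: "\<delta> > 0" and c_pos: "c > 0"
    and u_nonneg: "u \<ge> 0" and lambda0_pos: "lam0 > 0"
    and NL_poisson: "poisson_process M \<rho> NL"
    and Y_iid: "iid_seq M \<nu>Y Y"
    and Y_pos: "AE y in \<nu>Y. y > 0"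
    and NL_Y_indep:
      "indep_rv M (PiM {0..} (\<lambda>_. count_space UNIV)) (\<lambda>\<omega>. \<lambda>t\<in>{0..}. NL t \<omega>)
                 (PiM {1..} (\<lambda>_. borel)) (\<lambda>\<omega>. \<lambda>i\<in>{1..}. Y i \<omega>)"
    and N_cox: "cox_process M (shot_noise \<delta> lam0 NL Y) N"
    and U_iid: "iid_seq M \<nu>U U"
    and U_pos: "AE x in \<nu>U. x > 0"
    and U_cdf_continuous: "continuous_on UNIV (cdf \<nu>U)"
    and U_indep:
      "indep_rv M (PiM {0..} (\<lambda>_. borel) \<Otimes>\<^sub>M PiM {0..} (\<lambda>_. count_space UNIV))
                   (\<lambda>\<omega>. (\<lambda>t\<in>{0..}. shot_noise \<delta> lam0 NL Y t \<omega>, \<lambda>t\<in>{0..}. N t \<omega>))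
                 (PiM {1..} (\<lambda>_. borel)) (\<lambda>\<omega>. \<lambda>i\<in>{1..}. U i \<omega>)"
    and U_integrable: "integrable \<nu>U (\<lambda>x. x)"
    and Y_integrable: "integrable \<nu>Y (\<lambda>y. y)"
    and net_profit: "c > \<rho> / \<delta> * (\<integral>x. x \<partial>\<nu>U) * (\<integral>y. y \<partial>\<nu>Y)"

end

theory Submission
  imports Defs
begin

text \<open>
  Write \<open>L\<close> for the intensity and \<open>J\<close> for the running total of the shocks \<open>Y\<^sub>1 + Y\<^sub>2 + \<dots>\<close>, a compound
  Poisson process. The intensity decays at rate \<open>\<delta>\<close> between shocks and jumps with \<open>J\<close>, so on every path
  \<open>\<delta> \<integral>\<^sub>s\<^sup>t L = L\<^sub>s - L\<^sub>t + J\<^sub>t - J\<^sub>s\<close> (\<open>integral_L\<close>). This identity is what makes the exponent of the process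
  the right one.

  Fix \<open>s \<le> t\<close> and put \<open>\<mu> = \<integral>\<^sub>s\<^sup>t L\<close>. Given the whole path of \<open>L\<close>, the number of claims in the interval from \<open>s\<close> to
  \<open>t\<close> is Poisson with mean \<open>\<mu>\<close> (\<open>nn_integral_N_increments\<close>), and the claim sizes are independent of it; so the
  claims of that interval contribute the factor \<open>exp ((M\<^sub>U(r) - 1) \<mu>) = exp (- \<alpha> \<delta> \<mu>)\<close>, by the choice of
  \<open>\<alpha>\<close>. By the path identity this factor turns \<open>exp (- \<alpha> L\<^sub>t)\<close> into
  \<open>exp (- \<alpha> L\<^sub>s) exp (- \<alpha> (J\<^sub>t - J\<^sub>s))\<close>. The increment \<open>J\<^sub>t - J\<^sub>s\<close> is independent of the past of the
  intensity, and \<open>E exp (- \<alpha> (J\<^sub>t - J\<^sub>s)) = exp (\<rho> (t - s) (M\<^sub>Y(- \<alpha>) - 1))\<close>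
  (\<open>nn_integral_J_increment\<close>). Finally \<open>\<theta>\<close> is the rate that cancels this factor together with the
  premium income \<open>c (t - s)\<close>.

  To turn this computation into a conditional expectation, one needs events of the past of \<open>(X, L)\<close>
  that factor along the three sources of randomness. The value of \<open>X\<close> up to time \<open>s\<close> involves a random number of
  claims, so the past is cut into the strata \<open>N\<^sub>s = k\<close>; on each of them it is contained in the \<open>\<sigma>\<close>-algebra of
  \<open>N\<close>, \<open>L\<close> up to \<open>s\<close> and \<open>U\<^sub>1, \<dots>, U\<^sub>k\<close>, which is generated by intersections \<open>D \<inter> a \<inter> b\<close> of events
  of the three kinds. The computation is carried out on these (\<open>nn_integral_tilt_cylinder\<close>) and extended by Dynkin's
  theorem (\<open>nn_integral_tilt_surplus_past\<close>). The process is positive, so all of this takes place in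
  \<open>[0, \<infinity>]\<close>; at \<open>s = 0\<close> it gives expectation \<open>1\<close>, and with it integrability.

  An event of the augmented filtration at time \<open>s\<close> agrees, for each \<open>v > s\<close>, almost surely with an event of
  the past at \<open>v\<close>. So the martingale identity holds on it between \<open>v\<close> and \<open>t\<close>, and the limit
  \<open>v \<rightarrow> s\<close> may be taken: the paths are right-continuous and all expectations equal \<open>1\<close>, so that Scheffe's lemma gives
  convergence in \<open>L\<^sup>1\<close>.
\<close>

section \<open>Sigma-algebras generated by families of random variables\<close>

text \<open>The \<open>\<sigma>\<close>-algebra of a subfamily \<open>(Z\<^sub>i)\<close>, \<open>i \<in> I\<close>, for any index type and any target space:
  shocks and claims are indexed by \<^typ>\<open>nat\<close>, processes by \<^typ>\<open>real\<close>, and counts take values in \<^typ>\<open>nat\<close>.\<close>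

definition sigma_gen :: "'a set \<Rightarrow> 'b measure \<Rightarrow> ('i \<Rightarrow> 'a \<Rightarrow> 'b) \<Rightarrow> 'i set \<Rightarrow> 'a measure" where
  "sigma_gen \<Omega> S Z I = sigma \<Omega> {Z i -` A \<inter> \<Omega> | i A. i \<in> I \<and> A \<in> sets S}"

definition sigma_join :: "'a measure \<Rightarrow> 'a measure \<Rightarrow> 'a measure" where
  "sigma_join A B = sigma (space A) (sets A \<union> sets B)"

lemma space_sigma_gen [simp]: "space (sigma_gen \<Omega> S Z I) = \<Omega>"
  unfolding sigma_gen_def by (rule space_measure_of) auto

lemma sets_sigma_gen: "sets (sigma_gen \<Omega> S Z I) = sigma_sets \<Omega> {Z i -` A \<inter> \<Omega> | i A. i \<in> I \<and> A \<in> sets S}"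
  unfolding sigma_gen_def by (rule sets_measure_of) auto

lemma measurable_sigma_gen:
  assumes "i \<in> I" "Z i \<in> \<Omega> \<rightarrow> space S"
  shows "Z i \<in> measurable (sigma_gen \<Omega> S Z I) S"
  using assms unfolding measurable_def sets_sigma_gen by (auto intro!: sigma_sets.Basic)

lemma sets_sigma_gen_subset:
  assumes "space A = \<Omega>" "\<And>i. i \<in> I \<Longrightarrow> Z i \<in> measurable A S"
  shows "sets (sigma_gen \<Omega> S Z I) \<subseteq> sets A"
  unfolding sets_sigma_gen assms(1)[symmetric]
  by (rule sets.sigma_sets_subset) (auto intro: measurable_sets[OF assms(2)])

lemma sigma_gen_mono:
  assumes "I \<subseteq> K"
  shows "sets (sigma_gen \<Omega> S Z I) \<subseteq> sets (sigma_gen \<Omega> S Z K)"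
  unfolding sets_sigma_gen using assms by (intro sigma_sets_mono') auto

lemma generated_sigma_eq_sigma_gen: "generated_sigma M I Z = sigma_gen (space M) borel Z I"
  unfolding generated_sigma_def sigma_gen_def by (rule refl)

lemma space_sigma_join [simp]: "space B = space A \<Longrightarrow> space (sigma_join A B) = space A"
  unfolding sigma_join_def using sets.space_closed[of A] sets.space_closed[of B]
  by (intro space_measure_of) auto

lemma sets_sigma_join:
  "space B = space A \<Longrightarrow> sets (sigma_join A B) = sigma_sets (space A) (sets A \<union> sets B)"
  unfolding sigma_join_def using sets.space_closed[of A] sets.space_closed[of B]
  by (intro sets_measure_of) auto

lemma sets_sigma_join_upper:
  assumes "space B = space A"
  shows "sets A \<subseteq> sets (sigma_join A B)" "sets B \<subseteq> sets (sigma_join A B)"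
  using assms by (auto simp: sets_sigma_join intro: sigma_sets.Basic)

lemma sets_sigma_join_least:
  assumes "space A = space C" "space B = space C" "sets A \<subseteq> sets C" "sets B \<subseteq> sets C"
  shows "sets (sigma_join A B) \<subseteq> sets C"
  using sets.sigma_sets_subset[of "sets A \<union> sets B" C] assms by (simp add: sets_sigma_join)

lemma measurable_sets_mono:
  assumes "f \<in> measurable A S" "space A = space B" "sets A \<subseteq> sets B"
  shows "f \<in> measurable B S"
  using assms by (auto simp: measurable_def)

text \<open>The intersections form a \<open>\<inter>\<close>-stable generator, which is what independence and uniqueness
  arguments need.\<close>

lemma sets_sigma_join_Int:
  assumes "space B = space A"
  shows "sets (sigma_join A B) = sigma_sets (space A) {a \<inter> b | a b. a \<in> sets A \<and> b \<in> sets B}"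
    (is "_ = sigma_sets _ ?E")
proof (rule equalityI)
  have "sets A \<union> sets B \<subseteq> ?E"
  proof
    fix x assume "x \<in> sets A \<union> sets B"
    then show "x \<in> ?E"
    proof
      assume "x \<in> sets A"
      then have "x = x \<inter> space A" using sets.sets_into_space[of x A] by auto
      with \<open>x \<in> sets A\<close> show "x \<in> ?E" using sets.top[of B] assms by (intro CollectI exI[of _ x] exI[of _ "space A"]) auto
    next
      assume "x \<in> sets B"
      then have "x = space A \<inter> x" using sets.sets_into_space[of x B] assms by auto
      with \<open>x \<in> sets B\<close> show "x \<in> ?E"
        using sets.top[of A] by (intro CollectI exI[of _ x] exI[of _ "space A"]) auto
    qed
  qed
  then show "sets (sigma_join A B) \<subseteq> sigma_sets (space A) ?E"
    unfolding sets_sigma_join[OF assms] by (rule sigma_sets_mono')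
  have "?E \<subseteq> sets (sigma_join A B)"
    using sets_sigma_join_upper[OF assms] by (auto intro!: sets.Int)
  from sets.sigma_sets_subset[OF this] show "sigma_sets (space A) ?E \<subseteq> sets (sigma_join A B)"
    using assms by simp
qed

context prob_space
begin

lemma indep_set_mono:
  assumes "indep_set A B" "A' \<subseteq> A" "B' \<subseteq> B"
  shows "indep_set A' B'"
  using assms unfolding indep_sets2_eq by blast

text \<open>The form of independence used throughout: factors measurable with respect to independent
  \<open>\<sigma>\<close>-algebras can be integrated separately, as an identity in \<open>[0, \<infinity>]\<close>.\<close>

lemma nn_integral_indep_mult:
  fixes f g :: "'a \<Rightarrow> ennreal"
  assumes ind: "indep_set (sets A) (sets B)"
    and sp: "space A = space M" "space B = space M"
    and f: "f \<in> borel_measurable A" and g: "g \<in> borel_measurable B"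
  shows "(\<integral>\<^sup>+\<omega>. f \<omega> * g \<omega> \<partial>M) = (\<integral>\<^sup>+\<omega>. f \<omega> \<partial>M) * (\<integral>\<^sup>+\<omega>. g \<omega> \<partial>M)"
proof -
  have sub: "sets A \<subseteq> sets M" "sets B \<subseteq> sets M"
    using indep_setD_ev1[OF ind] indep_setD_ev2[OF ind] by auto
  have fM: "f \<in> borel_measurable M" "g \<in> borel_measurable M"
    using measurable_sets_mono[OF f sp(1) sub(1)] measurable_sets_mono[OF g sp(2) sub(2)] by auto
  have "sigma_sets (space M) {f -` X \<inter> space M | X. X \<in> sets borel} \<subseteq> sets A"
    unfolding sp(1)[symmetric] by (rule sets.sigma_sets_subset) (auto intro: measurable_sets[OF f])
  moreover have "sigma_sets (space M) {g -` X \<inter> space M | X. X \<in> sets borel} \<subseteq> sets B"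
    unfolding sp(2)[symmetric] by (rule sets.sigma_sets_subset) (auto intro: measurable_sets[OF g])
  ultimately have "indep_var borel f borel g"
    unfolding indep_var_eq using fM indep_set_mono[OF ind] by auto
  then have "indep_vars (case_bool borel borel) (case_bool f g) UNIV"
    unfolding indep_var_def .
  also have "case_bool borel borel = (\<lambda>_. borel :: ennreal measure)"
    by (auto simp: fun_eq_iff split: bool.split)
  finally have "indep_vars (\<lambda>_. borel) (case_bool f g) UNIV" .
  from indep_vars_nn_integral[OF _ this]
  have "(\<integral>\<^sup>+\<omega>. (\<Prod>i\<in>UNIV. case_bool f g i \<omega>) \<partial>M) = (\<Prod>i\<in>UNIV. \<integral>\<^sup>+\<omega>. case_bool f g i \<omega> \<partial>M)"
    by simp
  then show ?thesis by (simp add: UNIV_bool mult.commute)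
qed

text \<open>Regrouping four sources: if the pair \<open>A1, A2\<close> is independent of the pair \<open>B1, B2\<close> and there is independence
  inside each pair, then all four are independent, so they may be paired the other way round. It separates past
  from future when arrival times (\<open>A\<close>) and sizes (\<open>B\<close>) both have a past and a future part.\<close>

lemma indep_set_sigma_join:
  assumes ind: "indep_set (sets (sigma_join A1 A2)) (sets (sigma_join B1 B2))"
    and indA: "indep_set (sets A1) (sets A2)" and indB: "indep_set (sets B1) (sets B2)"
    and sp: "space A1 = space M" "space A2 = space M" "space B1 = space M" "space B2 = space M"
  shows "indep_set (sets (sigma_join A1 B1)) (sets (sigma_join A2 B2))"
proof -
  let ?P = "{a \<inter> b | a b. a \<in> sets A1 \<and> b \<in> sets B1}"
  let ?Q = "{a \<inter> b | a b. a \<in> sets A2 \<and> b \<in> sets B2}"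
  note ev = indep_setD_ev1[OF indA] indep_setD_ev2[OF indA] indep_setD_ev1[OF indB] indep_setD_ev2[OF indB]
  have up: "sets A1 \<subseteq> sets (sigma_join A1 A2)" "sets A2 \<subseteq> sets (sigma_join A1 A2)"
    "sets B1 \<subseteq> sets (sigma_join B1 B2)" "sets B2 \<subseteq> sets (sigma_join B1 B2)"
    by (simp_all add: sets_sigma_join_upper sp)
  have "indep_set ?P ?Q"
    unfolding indep_sets2_eq
  proof (intro conjI ballI)
    show "?P \<subseteq> events" "?Q \<subseteq> events" using ev by auto
    fix p q assume "p \<in> ?P" "q \<in> ?Q"
    then obtain a1 b1 a2 b2 where
      p: "p = a1 \<inter> b1" and q: "q = a2 \<inter> b2"
      and m: "a1 \<in> sets A1" "b1 \<in> sets B1" "a2 \<in> sets A2" "b2 \<in> sets B2" by auto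
    have "prob (p \<inter> q) = prob ((a1 \<inter> a2) \<inter> (b1 \<inter> b2))"
      unfolding p q by (rule arg_cong[of _ _ prob]) blast
    also have "\<dots> = prob (a1 \<inter> a2) * prob (b1 \<inter> b2)"
      using m up by (intro indep_setD[OF ind] sets.Int) auto
    also have "\<dots> = (prob a1 * prob a2) * (prob b1 * prob b2)"
      using indep_setD[OF indA] indep_setD[OF indB] m by simp
    also have "\<dots> = (prob a1 * prob b1) * (prob a2 * prob b2)" by simp
    also have "prob a1 * prob b1 = prob p"
      unfolding p using m up by (intro indep_setD[OF ind, symmetric]) auto
    also have "prob a2 * prob b2 = prob q"
      unfolding q using m up by (intro indep_setD[OF ind, symmetric]) auto
    finally show "prob (p \<inter> q) = prob p * prob q" .
  qed
  moreover have "Int_stable ?P" "Int_stable ?Q"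
  proof -
    have "Int_stable {a \<inter> b | a b. a \<in> sets A \<and> b \<in> sets B}" for A B :: "'a measure"
    proof (rule Int_stableI)
      fix p q assume "p \<in> {a \<inter> b | a b. a \<in> sets A \<and> b \<in> sets B}"
        "q \<in> {a \<inter> b | a b. a \<in> sets A \<and> b \<in> sets B}"
      then obtain a b a' b' where "p = a \<inter> b" "q = a' \<inter> b'" and
        m: "a \<in> sets A" "b \<in> sets B" "a' \<in> sets A" "b' \<in> sets B" by auto
      then have "p \<inter> q = (a \<inter> a') \<inter> (b \<inter> b')" by blast
      then show "p \<inter> q \<in> {a \<inter> b | a b. a \<in> sets A \<and> b \<in> sets B}"
        using m by blast
    qed
    then show "Int_stable ?P" "Int_stable ?Q" by blast+
  qed
  ultimately have "indep_set (sigma_sets (space M) ?P) (sigma_sets (space M) ?Q)"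
    by (rule indep_set_sigma_sets)
  then show ?thesis
    by (simp add: sets_sigma_join_Int sp)
qed

lemma indep_set_sigma_gen:
  assumes Z: "indep_vars (\<lambda>_. S) Z K" and sub: "I \<subseteq> K" "J \<subseteq> K" and disj: "I \<inter> J = {}"
  shows "indep_set (sets (sigma_gen (space M) S Z I)) (sets (sigma_gen (space M) S Z J))"
proof -
  let ?G = "\<lambda>i. {Z i -` A \<inter> space M | A. A \<in> sets S}"
  have "indep_sets (\<lambda>j. sigma_sets (space M) (\<Union>i\<in>case_bool I J j. ?G i)) UNIV"
  proof (rule indep_sets_collect_sigma)
    have "indep_sets ?G K" using Z unfolding indep_vars_def2 by auto
    then show "indep_sets ?G (\<Union>j\<in>UNIV. case_bool I J j)"
      by (rule indep_sets_mono_index[rotated]) (use sub in \<open>auto simp: UNIV_bool\<close>)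
    show "disjoint_family_on (case_bool I J) UNIV"
      using disj by (auto simp: disjoint_family_on_def split: bool.splits)
    fix i show "Int_stable (?G i)"
    proof (rule Int_stableI)
      fix a b assume "a \<in> ?G i" "b \<in> ?G i"
      then obtain A B where "a = Z i -` A \<inter> space M" "b = Z i -` B \<inter> space M" "A \<in> sets S" "B \<in> sets S"
        by auto
      then show "a \<inter> b \<in> ?G i" by (intro CollectI exI[of _ "A \<inter> B"]) auto
    qed
  qed
  moreover have "(\<Union>i\<in>I. ?G i) = {Z i -` A \<inter> space M | i A. i \<in> I \<and> A \<in> sets S}" for I by blast
  then have h: "sets (sigma_gen (space M) S Z I) = sigma_sets (space M) (\<Union>i\<in>I. ?G i)" for I
    unfolding sets_sigma_gen by simp
  ultimately show ?thesis unfolding indep_set_def h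
    by (rule_tac indep_sets_mono_sets) (auto split: bool.splits)
qed

end

text \<open>Uniqueness of measures, applied to the measures with densities \<open>f\<close> and \<open>g\<close>. Finiteness is needed
  for complements.\<close>

lemma nn_integral_eq_on_generated:
  fixes f g :: "'a \<Rightarrow> ennreal"
  assumes E: "Int_stable E" "E \<subseteq> sets M" "space M \<in> E"
    and f[measurable]: "f \<in> borel_measurable M" and g[measurable]: "g \<in> borel_measurable M"
    and fin: "(\<integral>\<^sup>+\<omega>. f \<omega> \<partial>M) \<noteq> \<infinity>"
    and eq: "\<And>A. A \<in> E \<Longrightarrow> (\<integral>\<^sup>+\<omega>. f \<omega> * indicator A \<omega> \<partial>M) = (\<integral>\<^sup>+\<omega>. g \<omega> * indicator A \<omega> \<partial>M)"
    and A: "A \<in> sigma_sets (space M) E"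
  shows "(\<integral>\<^sup>+\<omega>. f \<omega> * indicator A \<omega> \<partial>M) = (\<integral>\<^sup>+\<omega>. g \<omega> * indicator A \<omega> \<partial>M)"
proof -
  let ?f = "density M f" and ?g = "density M g"
  have sub: "sigma_sets (space M) E \<subseteq> sets M"
    using E(2) by (rule sets.sigma_sets_subset)
  have em: "emeasure (density M h) B = (\<integral>\<^sup>+\<omega>. h \<omega> * indicator B \<omega> \<partial>M)"
    if "h \<in> borel_measurable M" "B \<in> sigma_sets (space M) E" for h B
    using that sub by (intro emeasure_density) auto
  have "(\<integral>\<^sup>+\<omega>. h \<omega> * indicator (space M) \<omega> \<partial>M) = (\<integral>\<^sup>+\<omega>. h \<omega> \<partial>M)" for h
    by (intro nn_integral_cong) simp
  with eq[OF E(3)] fin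
  have tot: "emeasure ?f (space M) = emeasure ?g (space M)" "emeasure ?f (space M) \<noteq> \<infinity>"
    using em[OF f sigma_sets_top] em[OF g sigma_sets_top] by simp_all
  have "E \<subseteq> Pow (space M)" using E(2) sets.space_closed by auto
  from E(1) this A have "emeasure ?f A = emeasure ?g A"
  proof (induction rule: sigma_sets_induct_disjoint)
    case (basic A)
    then show ?case using eq[OF basic] em[OF f] em[OF g] by (simp add: sigma_sets.Basic)
  next
    case (compl A)
    have A: "A \<in> sets M" using compl sub by auto
    have fin: "emeasure ?f A \<noteq> \<infinity>" "emeasure ?g A \<noteq> \<infinity>"
      using emeasure_mono[of A "space M" ?f] A tot compl.IH sets.sets_into_space[OF A]
      by (auto simp: top_unique)
    show ?case
      using emeasure_compl[of A ?f] emeasure_compl[of A ?g] A fin tot compl.IH by simp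
  next
    case (union A)
    then have "range A \<subseteq> sets M" using sub by blast
    with union show ?case by (simp add: suminf_emeasure[symmetric])
  qed simp
  then show ?thesis using em[OF f A] em[OF g A] by simp
qed

section \<open>Sigma-algebras described stratum by stratum\<close>

text \<open>The events that, seen on \<open>K = k\<close>, are determined by the information \<open>A k\<close>. It expresses
  the past of a process that uses a random number \<open>K\<close> of the members of a sequence: on \<open>K = k\<close> only the first
  \<open>k\<close> of them are known.\<close>

definition stratified :: "'a set \<Rightarrow> (nat \<Rightarrow> 'a measure) \<Rightarrow> ('a \<Rightarrow> nat) \<Rightarrow> 'a measure" where
  "stratified \<Omega> A K = sigma \<Omega> {S. S \<subseteq> \<Omega> \<and> (\<forall>k. S \<inter> {\<omega>. K \<omega> = k} \<in> sets (A k))}"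

lemma space_stratified [simp]: "space (stratified \<Omega> A K) = \<Omega>"
  unfolding stratified_def by (rule space_measure_of) auto

text \<open>Once every \<open>A k\<close> can see the stratum \<open>K = k\<close>, the defining family is closed under complements, so
  nothing is added by generating.\<close>

lemma sets_stratified:
  assumes sp: "\<And>k. space (A k) = \<Omega>" and K: "\<And>k. {\<omega> \<in> \<Omega>. K \<omega> = k} \<in> sets (A k)"
  shows "sets (stratified \<Omega> A K) = {S. S \<subseteq> \<Omega> \<and> (\<forall>k. S \<inter> {\<omega>. K \<omega> = k} \<in> sets (A k))}" (is "_ = ?S")
proof -
  have "sigma_algebra \<Omega> ?S"
    unfolding sigma_algebra_iff2
  proof (intro conjI ballI allI impI)
    fix S assume S: "S \<in> ?S"
    have "(\<Omega> - S) \<inter> {\<omega>. K \<omega> = k} = {\<omega> \<in> \<Omega>. K \<omega> = k} - S \<inter> {\<omega>. K \<omega> = k}" for k by blast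
    then show "\<Omega> - S \<in> ?S" using S K by auto
  next
    fix S :: "nat \<Rightarrow> 'a set" assume S: "range S \<subseteq> ?S"
    have "(\<Union>i. S i) \<inter> {\<omega>. K \<omega> = k} = (\<Union>i. S i \<inter> {\<omega>. K \<omega> = k})" for k by blast
    moreover have "(\<Union>i. S i \<inter> {\<omega>. K \<omega> = k}) \<in> sets (A k)" for k using S by (intro sets.countable_UN) auto
    ultimately show "(\<Union>i. S i) \<in> ?S" using S by auto
  qed auto
  then show ?thesis
    unfolding stratified_def by (subst sets_measure_of) (auto simp: sigma_algebra.sigma_sets_eq)
qed

lemma measurable_stratifiedI:
  assumes sp: "\<And>k. space (A k) = \<Omega>" and K: "\<And>k. {\<omega> \<in> \<Omega>. K \<omega> = k} \<in> sets (A k)"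
    and f: "\<And>k. g k \<in> measurable (A k) S" "\<And>\<omega>. \<omega> \<in> \<Omega> \<Longrightarrow> f \<omega> = g (K \<omega>) \<omega>"
  shows "f \<in> measurable (stratified \<Omega> A K) S"
proof (rule measurableI)
  fix \<omega> assume "\<omega> \<in> space (stratified \<Omega> A K)"
  then show "f \<omega> \<in> space S" using f measurable_space[OF f(1), of \<omega> "K \<omega>"] sp by simp
next
  fix B assume B: "B \<in> sets S"
  have "f -` B \<inter> \<Omega> \<inter> {\<omega>. K \<omega> = k} = (g k -` B \<inter> space (A k)) \<inter> {\<omega> \<in> \<Omega>. K \<omega> = k}" for k
    using f(2) sp by auto
  then show "f -` B \<inter> space (stratified \<Omega> A K) \<in> sets (stratified \<Omega> A K)"
    unfolding sets_stratified[OF sp K] using B f(1) K by (auto intro!: sets.Int measurable_sets)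
qed

text \<open>Converse to the previous lemma: a function measurable for the stratified \<open>\<sigma>\<close>-algebra,
  cut off outside a stratum, depends only on the information of that stratum.\<close>

lemma measurable_on_stratum:
  fixes f :: "'a \<Rightarrow> ennreal"
  assumes sp: "\<And>k. space (A k) = \<Omega>" and K: "\<And>k. {\<omega> \<in> \<Omega>. K \<omega> = k} \<in> sets (A k)"
    and f: "f \<in> borel_measurable (stratified \<Omega> A K)"
  shows "(\<lambda>\<omega>. f \<omega> * indicator {k} (K \<omega>)) \<in> borel_measurable (A k)"
proof -
  have "(\<lambda>\<omega>. if K \<omega> = k then f \<omega> else 0) \<in> borel_measurable (A k)"
  proof (rule measurableI)
    fix B :: "ennreal set" assume "B \<in> sets borel"
    then have "f -` B \<inter> \<Omega> \<in> sets (stratified \<Omega> A K)" using measurable_sets[OF f, of B] by simp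
    then have *: "f -` B \<inter> \<Omega> \<inter> {\<omega>. K \<omega> = k} \<in> sets (A k)"
      using sets_stratified[OF sp K] by auto
    have "(\<lambda>\<omega>. if K \<omega> = k then f \<omega> else 0) -` B \<inter> space (A k) =
      (f -` B \<inter> \<Omega> \<inter> {\<omega>. K \<omega> = k}) \<union> (if 0 \<in> B then space (A k) - {\<omega> \<in> \<Omega>. K \<omega> = k} else {})"
      using sp by (auto split: if_splits)
    also have "\<dots> \<in> sets (A k)" using * K[of k] by auto
    finally show "(\<lambda>\<omega>. if K \<omega> = k then f \<omega> else 0) -` B \<inter> space (A k) \<in> sets (A k)" .
  qed simp
  also have "(\<lambda>\<omega>. if K \<omega> = k then f \<omega> else 0) = (\<lambda>\<omega>. f \<omega> * indicator {k} (K \<omega>))"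
    by (auto simp: indicator_def fun_eq_iff)
  finally show ?thesis .
qed

lemma sets_stratified_subset:
  assumes sp: "\<And>k. space (A k) = space B" and K: "\<And>k. {\<omega> \<in> space B. K \<omega> = k} \<in> sets (A k)"
    and sub: "\<And>k. sets (A k) \<subseteq> sets B"
  shows "sets (stratified (space B) A K) \<subseteq> sets B"
proof
  fix S assume "S \<in> sets (stratified (space B) A K)"
  then have "S \<inter> {\<omega>. K \<omega> = k} \<in> sets (A k)" for k
    using sets_stratified[OF sp K] by auto
  then have "S \<inter> {\<omega>. K \<omega> = k} \<in> sets B" for k
    using subsetD[OF sub] by blast
  then have "(\<Union>k. S \<inter> {\<omega>. K \<omega> = k}) \<in> sets B" by (intro sets.countable_UN) auto
  also have "(\<Union>k. S \<inter> {\<omega>. K \<omega> = k}) = S" by auto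
  finally show "S \<in> sets B" .
qed

lemma nn_integral_split_nat:
  fixes f :: "'a \<Rightarrow> ennreal"
  assumes [measurable]: "f \<in> borel_measurable M" and K: "K \<in> measurable M (count_space (UNIV :: nat set))"
  shows "(\<integral>\<^sup>+\<omega>. f \<omega> \<partial>M) = (\<Sum>k. \<integral>\<^sup>+\<omega>. f \<omega> * indicator {k} (K \<omega>) \<partial>M)"
proof -
  have [measurable]: "(\<lambda>\<omega>. indicator {k} (K \<omega>) :: ennreal) \<in> borel_measurable M" for k
    by (rule measurable_compose[OF K]) simp
  have "(\<Sum>k. \<integral>\<^sup>+\<omega>. f \<omega> * indicator {k} (K \<omega>) \<partial>M) = (\<integral>\<^sup>+\<omega>. (\<Sum>k. f \<omega> * indicator {k} (K \<omega>)) \<partial>M)"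
    by (rule nn_integral_suminf[symmetric]) measurable
  also have "\<dots> = (\<integral>\<^sup>+\<omega>. f \<omega> \<partial>M)"
  proof (intro nn_integral_cong)
    fix \<omega>
    have "(\<Sum>k. f \<omega> * indicator {k} (K \<omega>)) = (\<Sum>k\<in>{K \<omega>}. f \<omega> * indicator {k} (K \<omega>))"
      by (rule suminf_finite) auto
    then show "(\<Sum>k. f \<omega> * indicator {k} (K \<omega>)) = f \<omega>" by simp
  qed
  finally show ?thesis by simp
qed

section \<open>Counting processes\<close>

text \<open>The values are prescribed exactly, so that two such events intersect in an event of the same
  kind or in the empty set; the latter is added to obtain a \<open>\<inter>\<close>-stable family.\<close>

definition cylinders :: "'a set \<Rightarrow> (real \<Rightarrow> 'a \<Rightarrow> nat) \<Rightarrow> real set \<Rightarrow> 'a set set" where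
  "cylinders \<Omega> N I = insert {} {{\<omega> \<in> \<Omega>. \<forall>v\<in>V. N v \<omega> = a v} | V a. finite V \<and> V \<subseteq> I}"

lemma cylindersI: "finite V \<Longrightarrow> V \<subseteq> I \<Longrightarrow> {\<omega> \<in> \<Omega>. \<forall>v\<in>V. N v \<omega> = a v} \<in> cylinders \<Omega> N I"
  unfolding cylinders_def by blast

lemma space_in_cylinders: "\<Omega> \<in> cylinders \<Omega> N I"
  using cylindersI[of "{}" I \<Omega> N] by simp

lemma Int_stable_cylinders: "Int_stable (cylinders \<Omega> N I)"
proof (rule Int_stableI)
  fix A B assume A: "A \<in> cylinders \<Omega> N I" and B: "B \<in> cylinders \<Omega> N I"
  show "A \<inter> B \<in> cylinders \<Omega> N I"
  proof (cases "A \<inter> B = {}")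
    case False
    then obtain w where w: "w \<in> A" "w \<in> B" by auto
    obtain V a where V: "A = {\<omega> \<in> \<Omega>. \<forall>v\<in>V. N v \<omega> = a v}" "finite V" "V \<subseteq> I"
      using A w unfolding cylinders_def by auto
    obtain V' a' where V': "B = {\<omega> \<in> \<Omega>. \<forall>v\<in>V'. N v \<omega> = a' v}" "finite V'" "V' \<subseteq> I"
      using B w unfolding cylinders_def by auto
    have "A \<inter> B = {\<omega> \<in> \<Omega>. \<forall>v\<in>V \<union> V'. N v \<omega> = N v w}"
      using w unfolding V(1) V'(1) by auto
    also have "\<dots> \<in> cylinders \<Omega> N I" using V V' by (intro cylindersI) auto
    finally show ?thesis .
  qed (simp add: cylinders_def)
qed

lemma sets_sigma_gen_cylinders:
  "sets (sigma_gen \<Omega> (count_space UNIV) N I) \<subseteq> sigma_sets \<Omega> (cylinders \<Omega> N I)"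
proof -
  have sub: "cylinders \<Omega> N I \<subseteq> Pow \<Omega>" unfolding cylinders_def by auto
  have "N i -` A \<inter> \<Omega> \<in> sigma_sets \<Omega> (cylinders \<Omega> N I)" if "i \<in> I" for i A
  proof -
    interpret sigma_algebra \<Omega> "sigma_sets \<Omega> (cylinders \<Omega> N I)"
      using sub by (rule sigma_algebra_sigma_sets)
    have "N i -` A \<inter> \<Omega> = (\<Union>n\<in>A. {\<omega> \<in> \<Omega>. \<forall>v\<in>{i}. N v \<omega> = n})" by auto
    also have "\<dots> \<in> sigma_sets \<Omega> (cylinders \<Omega> N I)"
      using that by (intro countable_UN'' sigma_sets.Basic cylindersI) auto
    finally show ?thesis .
  qed
  then show ?thesis unfolding sets_sigma_gen by (intro sigma_sets_mono) auto
qed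

lemma cylinders_subset_events:
  assumes "\<And>i. i \<in> I \<Longrightarrow> N i \<in> measurable M (count_space UNIV)"
  shows "cylinders (space M) N I \<subseteq> sets M"
proof -
  have "{\<omega> \<in> space M. \<forall>v\<in>V. N v \<omega> = a v} \<in> sets M" if "finite V" "V \<subseteq> I" for V a
  proof (rule sets.sets_Collect_finite_All)
    fix i assume "i \<in> V"
    then have "N i -` {a i} \<inter> space M \<in> sets M" using that assms by (intro measurable_sets) auto
    then show "{\<omega> \<in> space M. N i \<omega> = a i} \<in> sets M"
      by (simp add: vimage_def Int_def conj_commute)
  qed (use that in auto)
  then show ?thesis unfolding cylinders_def by auto
qed

lemma counting_process_mono:
  assumes "counting_process M N" "\<omega> \<in> space M" "0 \<le> s" "s \<le> t"
  shows "N s \<omega> \<le> N t \<omega>"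
  using assms unfolding counting_process_def by blast

text \<open>The laws of Poisson and Cox processes are given through increments over consecutive
  intervals, whereas pasts are generated by values. Prescribing values at finitely many times, among them \<open>0\<close> (where the
  value is \<open>0\<close>) and \<open>s\<close>, is the same as prescribing the increments between them.\<close>

lemma cylinder_as_increments:
  assumes N: "counting_process M N" and s: "0 \<le> s"
    and D: "D \<in> cylinders (space M) N {0..s}" "D \<inter> {\<omega>. N s \<omega> = k} \<noteq> {}"
  obtains n \<tau> \<kappa> where "\<tau> 0 = 0" "\<forall>i<n. \<tau> i \<le> \<tau> (Suc i)" "\<tau> n = s"
    "D \<inter> {\<omega>. N s \<omega> = k} = {\<omega> \<in> space M. \<forall>i<n. N (\<tau> (Suc i)) \<omega> - N (\<tau> i) \<omega> = \<kappa> i}"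
proof -
  (* A path w in the event serves as reference: its values are the prescribed ones,
     and as values of a path they are monotone and start at 0. *)
  obtain w where w: "w \<in> D" "N s w = k" using D(2) by auto
  obtain V a where V: "D = {\<omega> \<in> space M. \<forall>v\<in>V. N v \<omega> = a v}" "finite V" "V \<subseteq> {0..s}"
    using D(1) w unfolding cylinders_def by auto
  define W where "W = insert 0 (insert s V)"
  have W: "finite W" "W \<subseteq> {0..s}" "0 \<in> W" "s \<in> W" using V s unfolding W_def by auto
  define xs where "xs = sorted_list_of_set W"
  have xs: "set xs = W" "sorted xs" "xs \<noteq> []" using W unfolding xs_def by auto
  define n where "n = length xs - 1"
  have len: "length xs = Suc n" using xs(3) unfolding n_def by simp
  define \<tau> where "\<tau> i = xs ! i" for i
  have mono: "\<tau> i \<le> \<tau> j" if "i \<le> j" "j \<le> n" for i j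
    using sorted_nth_mono[OF xs(2)] that len unfolding \<tau>_def by simp
  have range: "\<tau> ` {..n} = W"
    using len unfolding xs(1)[symmetric] \<tau>_def by (auto simp: set_conv_nth less_Suc_eq_le)
  have in_W: "0 \<le> \<tau> i" "\<tau> i \<le> s" if "i \<le> n" for i using range W that by auto
  obtain i0 where "i0 \<le> n" "\<tau> i0 = 0" using range W(3) by (metis (no_types, lifting) imageE atMost_iff)
  then have tau0: "\<tau> 0 = 0" using mono[of 0 i0] in_W[of 0] by simp
  obtain i1 where "i1 \<le> n" "\<tau> i1 = s" using range W(4) by (metis (no_types, lifting) imageE atMost_iff)
  then have taun: "\<tau> n = s" using mono[of i1 n] in_W[of n] by simp
  define \<kappa> where "\<kappa> i = N (\<tau> (Suc i)) w - N (\<tau> i) w" for i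
  have w_space: "w \<in> space M" using w V by auto
  have zero: "N 0 \<omega> = 0" if "\<omega> \<in> space M" for \<omega> using N that unfolding counting_process_def by blast
  have inc: "N (\<tau> i) \<omega> \<le> N (\<tau> (Suc i)) \<omega>" if "i < n" "\<omega> \<in> space M" for i \<omega>
    using that mono[of i "Suc i"] in_W[of i] by (intro counting_process_mono[OF N]) auto
  have "D \<inter> {\<omega>. N s \<omega> = k} = {\<omega> \<in> space M. \<forall>v\<in>W. N v \<omega> = N v w}"
    using w zero w_space unfolding V(1) W_def by auto
  also have "\<dots> = {\<omega> \<in> space M. \<forall>i\<le>n. N (\<tau> i) \<omega> = N (\<tau> i) w}"
    unfolding range[symmetric] by auto
  also have "\<dots> = {\<omega> \<in> space M. \<forall>i<n. N (\<tau> (Suc i)) \<omega> - N (\<tau> i) \<omega> = \<kappa> i}"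
  proof (intro Collect_cong conj_cong refl iffI)
    fix \<omega> assume "\<omega> \<in> space M" "\<forall>i<n. N (\<tau> (Suc i)) \<omega> - N (\<tau> i) \<omega> = \<kappa> i"
    have "i \<le> n \<Longrightarrow> N (\<tau> i) \<omega> = N (\<tau> i) w" for i
    proof (induction i)
      case 0 then show ?case using zero tau0 w_space \<open>\<omega> \<in> space M\<close> by simp
    next
      case (Suc i)
      then have "N (\<tau> (Suc i)) \<omega> - N (\<tau> i) \<omega> = N (\<tau> (Suc i)) w - N (\<tau> i) w" "N (\<tau> i) \<omega> = N (\<tau> i) w"
        using \<open>\<forall>i<n. N (\<tau> (Suc i)) \<omega> - N (\<tau> i) \<omega> = \<kappa> i\<close>[rule_format, of i]
          unfolding \<kappa>_def by simp_all
      with inc[of i \<omega>] inc[of i w] Suc.prems w_space \<open>\<omega> \<in> space M\<close> show ?case by simp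
    qed
    then show "\<forall>i\<le>n. N (\<tau> i) \<omega> = N (\<tau> i) w" by simp
  qed (auto simp: \<kappa>_def)
  finally show ?thesis using that[of \<tau> n \<kappa>] tau0 taun mono by simp
qed

lemma counting_process_locally_constant:
  assumes "counting_process M N" "\<omega> \<in> space M" "0 \<le> t"
  shows "\<forall>\<^sub>F s in at_right t. N s \<omega> = N t \<omega>"
  using assms unfolding counting_process_def by (auto simp: continuous_within tendsto_discrete)

text \<open>The infimum defining the jump time is attained because a right-continuous path with values in
  \<^typ>\<open>nat\<close> is constant just after each time. The hypothesis \<open>i \<le> N t \<omega>\<close> for some \<open>t\<close> excludes the infimum of the
  empty set.\<close>

lemma jump_time_le_iff:
  assumes N: "counting_process M N" "\<omega> \<in> space M" and t: "0 \<le> t" "i \<le> N t \<omega>" and v: "0 \<le> v"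
  shows "jump_time N i \<omega> \<le> v \<longleftrightarrow> i \<le> N v \<omega>"
proof -
  define S where "S = {t. 0 \<le> t \<and> i \<le> N t \<omega>}"
  have T: "jump_time N i \<omega> = Inf S" unfolding jump_time_def S_def ..
  have S: "S \<noteq> {}" "bdd_below S" using t unfolding S_def by (auto intro!: bdd_belowI[of _ 0])
  have T0: "0 \<le> Inf S" using S(1) unfolding S_def by (intro cInf_greatest) auto
  have "Inf S \<in> S"
  proof -
    from counting_process_locally_constant[OF N T0]
    obtain b where b: "b > Inf S" "\<And>y. y > Inf S \<Longrightarrow> y < b \<Longrightarrow> N y \<omega> = N (Inf S) \<omega>"
      unfolding eventually_at_right_field by auto
    obtain x where x: "x \<in> S" "x < b" using cInf_lessD[OF S(1) b(1)] by auto
    have "Inf S \<le> x" using S(2) x(1) by (rule cInf_lower[rotated])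
    then show ?thesis using b(2)[of x] x T0 by (cases "x = Inf S") (simp_all add: S_def)
  qed
  then have "i \<le> N (Inf S) \<omega>" by (simp add: S_def)
  show ?thesis
  proof
    assume "jump_time N i \<omega> \<le> v"
    then have "N (Inf S) \<omega> \<le> N v \<omega>"
      unfolding T by (intro counting_process_mono[OF N T0]) auto
    with \<open>i \<le> N (Inf S) \<omega>\<close> show "i \<le> N v \<omega>" by simp
  next
    assume "i \<le> N v \<omega>"
    then show "jump_time N i \<omega> \<le> v" unfolding T using v S(2) by (intro cInf_lower) (auto simp: S_def)
  qed
qed

lemma sum_count_extend:
  fixes f :: "nat \<Rightarrow> real"
  assumes N: "counting_process M N" and "\<omega> \<in> space M" "0 \<le> v" "v \<le> s"
  shows "(\<Sum>i=1..N v \<omega>. f i) = (\<Sum>i=1..N s \<omega>. if i \<le> N v \<omega> then f i else 0)"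
proof -
  have "{1..N v \<omega>} = {i \<in> {1..N s \<omega>}. i \<le> N v \<omega>}"
    using counting_process_mono[OF assms] by auto
  then show ?thesis by (simp only: sum.inter_filter[OF finite_atLeastAtMost])
qed

section \<open>Poisson weights, exponential moments and conditional probabilities\<close>

definition poisson_weight :: "real \<Rightarrow> nat \<Rightarrow> real" where
  "poisson_weight \<mu> k = \<mu> ^ k / fact k * exp (- \<mu>)"

lemma poisson_weight_nonneg: "0 \<le> \<mu> \<Longrightarrow> 0 \<le> poisson_weight \<mu> k"
  by (simp add: poisson_weight_def)

lemma borel_measurable_poisson_weight [measurable]:
  assumes [measurable]: "f \<in> borel_measurable M"
  shows "(\<lambda>x. poisson_weight (f x) k) \<in> borel_measurable M"
  unfolding poisson_weight_def by measurable

text \<open>The probability generating function of the Poisson law. It is used at \<open>q = M\<^sub>U(r)\<close> for the claims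
  and at \<open>q = M\<^sub>Y(- \<alpha>)\<close> for the shocks.\<close>

lemma poisson_weight_pgf:
  assumes "0 \<le> \<mu>" "0 \<le> q"
  shows "(\<Sum>k. ennreal (poisson_weight \<mu> k) * ennreal q ^ k) = ennreal (exp ((q - 1) * \<mu>))"
proof -
  have "(\<lambda>k. (\<mu> * q) ^ k /\<^sub>R fact k) sums exp (\<mu> * q)" by (rule exp_converges)
  then have "(\<lambda>k. (\<mu> * q) ^ k /\<^sub>R fact k * exp (- \<mu>)) sums (exp (\<mu> * q) * exp (- \<mu>))"
    by (rule sums_mult2)
  also have "(\<lambda>k. (\<mu> * q) ^ k /\<^sub>R fact k * exp (- \<mu>)) = (\<lambda>k. poisson_weight \<mu> k * q ^ k)"
    by (simp add: poisson_weight_def power_mult_distrib field_simps fun_eq_iff)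
  also have "exp (\<mu> * q) * exp (- \<mu>) = exp ((q - 1) * \<mu>)"
    by (simp add: exp_add[symmetric] algebra_simps)
  finally have "(\<Sum>k. ennreal (poisson_weight \<mu> k * q ^ k)) = ennreal (exp ((q - 1) * \<mu>))"
    using assms by (intro suminf_ennreal_eq) (auto intro!: mult_nonneg_nonneg poisson_weight_nonneg)
  then show ?thesis
    using assms by (simp add: ennreal_mult'' ennreal_power)
qed

lemma (in prob_space) nn_integral_prod_iid:
  fixes g :: "real \<Rightarrow> ennreal"
  assumes Z: "iid_seq M \<nu> Z" and g[measurable]: "g \<in> borel_measurable borel" and K: "finite K" "K \<subseteq> {1..}"
  shows "(\<integral>\<^sup>+\<omega>. (\<Prod>i\<in>K. g (Z i \<omega>)) \<partial>M) = (\<integral>\<^sup>+x. g x \<partial>\<nu>) ^ card K"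
proof -
  have iv: "indep_vars (\<lambda>_. borel) Z {1..}" using Z unfolding iid_seq_def by auto
  have rv: "Z i \<in> borel_measurable M" if "i \<in> K" for i
    using iv K that unfolding indep_vars_def2 by auto
  have "indep_vars (\<lambda>_. borel) (\<lambda>i \<omega>. g (Z i \<omega>)) K"
    by (rule indep_vars_compose2[OF indep_vars_subset[OF iv K(2)]]) simp
  from indep_vars_nn_integral[OF K(1) this]
  have "(\<integral>\<^sup>+\<omega>. (\<Prod>i\<in>K. g (Z i \<omega>)) \<partial>M) = (\<Prod>i\<in>K. \<integral>\<^sup>+\<omega>. g (Z i \<omega>) \<partial>M)" by simp
  also have "\<dots> = (\<Prod>i\<in>K. \<integral>\<^sup>+x. g x \<partial>\<nu>)"
  proof (rule prod.cong[OF refl])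
    fix i assume i: "i \<in> K"
    then have "\<nu> = distr M borel (Z i)" using Z K unfolding iid_seq_def by auto
    then show "(\<integral>\<^sup>+\<omega>. g (Z i \<omega>) \<partial>M) = (\<integral>\<^sup>+x. g x \<partial>\<nu>)"
      using rv[OF i] by (simp add: nn_integral_distr)
  qed
  finally show ?thesis by simp
qed

lemma nn_integral_exp_eq_mgf:
  assumes "integrable \<nu> (\<lambda>y. exp (a * y))"
  shows "(\<integral>\<^sup>+y. ennreal (exp (a * y)) \<partial>\<nu>) = ennreal (mgf \<nu> a)"
  unfolding mgf_def using assms by (intro nn_integral_eq_integral) auto

lemma mgf_nonneg: "0 \<le> mgf \<nu> a"
  unfolding mgf_def by (intro Bochner_Integration.integral_nonneg) auto

text \<open>The contribution of one shock at time \<open>T\<close> to the integrated intensity. The right-hand side says that what the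
  integral (times \<open>\<delta>\<close>) collects is the initial value, plus the unit jump if it happens inside the interval, minus what
  is left at the end.\<close>

lemma has_bochner_integral_exp_decay:
  fixes a b T \<delta> :: real
  assumes "a \<le> b" "\<delta> > 0"
  defines "G \<equiv> \<lambda>v. if T \<le> v then exp (- \<delta> * (v - T)) else 0"
  shows "has_bochner_integral lborel (\<lambda>v. indicator {a..b} v *\<^sub>R G v)
    ((G a - G b + (if T \<le> b then 1 else 0) - (if T \<le> a then 1 else 0)) / \<delta>)"
proof (cases "T \<le> b")
  case False
  then have "(\<lambda>v. indicator {a..b} v *\<^sub>R G v) = (\<lambda>_. 0)" by (auto simp: G_def indicator_def fun_eq_iff)
  then show ?thesis using False assms(1) by (auto simp: G_def)
next
  case True
  define m where "m = max a T"
  have m: "m \<le> b" using True assms(1) by (simp add: m_def)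
  have "has_bochner_integral lborel (\<lambda>v. indicator {m..b} v *\<^sub>R exp (- \<delta> * (v - T)))
    (- exp (- \<delta> * (b - T)) / \<delta> - - exp (- \<delta> * (m - T)) / \<delta>)"
  proof (rule has_bochner_integral_FTC_Icc[OF m])
    fix x show "((\<lambda>v. - exp (- \<delta> * (v - T)) / \<delta>) has_vector_derivative exp (- \<delta> * (x - T))) (at x within {m..b})"
      unfolding has_real_derivative_iff_has_vector_derivative[symmetric]
      using assms(2) by (auto intro!: derivative_eq_intros)
  qed (intro continuous_intros)
  moreover have "(\<lambda>v. indicator {m..b} v *\<^sub>R exp (- \<delta> * (v - T))) = (\<lambda>v. indicator {a..b} v *\<^sub>R G v)"
    by (auto simp: G_def m_def indicator_def fun_eq_iff)
  moreover have "- exp (- \<delta> * (b - T)) / \<delta> - - exp (- \<delta> * (m - T)) / \<delta>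
     = (G a - G b + (if T \<le> b then 1 else 0) - (if T \<le> a then 1 else 0)) / \<delta>"
    using True assms by (auto simp: G_def m_def max_def field_simps)
  ultimately show ?thesis by simp
qed

text \<open>Conditional probabilities are given as real-valued
  conditional expectations; for nonnegative weights \<open>f\<close> without integrability they have to be read through the
  extended nonnegative version, with which they agree almost everywhere because an indicator has finite integral.\<close>

lemma (in finite_measure_subalgebra) nn_integral_real_cond_exp_indicator:
  fixes f :: "'a \<Rightarrow> ennreal"
  assumes f: "f \<in> borel_measurable F" and D[measurable]: "D \<in> sets M"
  shows "(\<integral>\<^sup>+\<omega>. f \<omega> * indicator D \<omega> \<partial>M) = (\<integral>\<^sup>+\<omega>. f \<omega> * ennreal (real_cond_exp M F (indicator D) \<omega>) \<partial>M)"
proof -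
  let ?e = "nn_cond_exp M F (indicator D)"
  have "(\<integral>\<^sup>+\<omega>. ?e \<omega> \<partial>M) = (\<integral>\<^sup>+\<omega>. indicator D \<omega> \<partial>M)"
    using nn_cond_exp_intg[of "\<lambda>_. 1" "indicator D"] by simp
  then have "(\<integral>\<^sup>+\<omega>. ?e \<omega> \<partial>M) \<noteq> \<infinity>" by simp
  then have fin: "AE \<omega> in M. ?e \<omega> \<noteq> \<infinity>"
    by (intro nn_integral_noteq_infinite) auto
  have zero: "AE \<omega> in M. nn_cond_exp M F (\<lambda>_. 0) \<omega> = 0"
    using nn_cond_exp_F_meas[of "\<lambda>_. 0"] by auto
  have "(\<lambda>x. ennreal (- indicator D x)) = (\<lambda>_. 0)" "(\<lambda>x. ennreal (indicator D x)) = indicator D"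
    by (auto simp: indicator_def fun_eq_iff ennreal_neg)
  then have "real_cond_exp M F (indicator D) = (\<lambda>x. enn2real (?e x) - enn2real (nn_cond_exp M F (\<lambda>_. 0) x))"
    unfolding real_cond_exp_def by simp
  with fin zero have "AE \<omega> in M. ennreal (real_cond_exp M F (indicator D) \<omega>) = ?e \<omega>"
    by (auto simp: less_top elim!: AE_mp)
  then have "(\<integral>\<^sup>+\<omega>. f \<omega> * ennreal (real_cond_exp M F (indicator D) \<omega>) \<partial>M) = (\<integral>\<^sup>+\<omega>. f \<omega> * ?e \<omega> \<partial>M)"
    by (intro nn_integral_cong_AE) auto
  then show ?thesis using nn_cond_exp_intg[OF f, of "indicator D"] by simp
qed

section \<open>Measurability and independence in the risk model\<close>

context shot_noise_risk_model
begin

abbreviation L :: "real \<Rightarrow> 'a \<Rightarrow> real" where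
  "L \<equiv> shot_noise \<delta> lam0 NL Y"

abbreviation X :: "real \<Rightarrow> 'a \<Rightarrow> real" where
  "X \<equiv> surplus c u N U"

text \<open>The compound Poisson process of the shocks: the noise that drives the intensity.\<close>

definition J :: "real \<Rightarrow> 'a \<Rightarrow> real" where
  "J t \<omega> = (\<Sum>i=1..NL t \<omega>. Y i \<omega>)"

lemma NL_counting: "counting_process M NL" and N_counting: "counting_process M N"
  using NL_poisson N_cox unfolding poisson_process_def cox_process_def by auto

lemma NL_measurable: "0 \<le> t \<Longrightarrow> NL t \<in> measurable M (count_space UNIV)"
  using NL_counting unfolding counting_process_def by auto

lemma N_measurable: "0 \<le> t \<Longrightarrow> N t \<in> measurable M (count_space UNIV)"
  using N_counting unfolding counting_process_def by auto

lemma Y_measurable: "1 \<le> i \<Longrightarrow> Y i \<in> borel_measurable M"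
  using Y_iid unfolding iid_seq_def indep_vars_def2 by auto

lemma U_measurable: "1 \<le> i \<Longrightarrow> U i \<in> borel_measurable M"
  using U_iid unfolding iid_seq_def indep_vars_def2 by auto

lemma L_measurable:
  assumes "0 \<le> t" shows "L t \<in> borel_measurable M"
proof -
  have "(\<lambda>\<omega>. (\<lambda>t\<in>{0..}. L t \<omega>, \<lambda>t\<in>{0..}. N t \<omega>))
    \<in> measurable M (PiM {0..} (\<lambda>_. borel) \<Otimes>\<^sub>M PiM {0..} (\<lambda>_. count_space UNIV))"
    using U_indep unfolding indep_rv_def by auto
  from measurable_compose[OF measurable_compose[OF this measurable_fst] measurable_component_singleton[of t]] assms
  show ?thesis by simp
qed

lemma indep_L_N_U:
  "indep_set (sets (sigma_join (sigma_gen (space M) borel L {0..}) (sigma_gen (space M) (count_space UNIV) N {0..})))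
    (sets (sigma_gen (space M) borel U {1..}))"
proof -
  let ?S = "PiM {0..} (\<lambda>_. borel) \<Otimes>\<^sub>M PiM {0..} (\<lambda>_. count_space UNIV)"
  let ?V = "\<lambda>\<omega>. (\<lambda>t\<in>{0::real..}. L t \<omega>, \<lambda>t\<in>{0::real..}. N t \<omega>)"
  let ?W = "\<lambda>\<omega>. \<lambda>i\<in>{1..}. U i \<omega>"
  have V: "?V \<in> space M \<rightarrow> space ?S" and W: "?W \<in> space M \<rightarrow> space (PiM {1..} (\<lambda>_. borel))"
    by (auto simp: space_pair_measure space_PiM)
  note V' = measurable_vimage_algebra1[OF V] and W' = measurable_vimage_algebra1[OF W]
  show ?thesis
  proof (rule indep_set_mono)
    show "indep_set (sets (vimage_algebra (space M) ?V ?S))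
       (sets (vimage_algebra (space M) ?W (PiM {1..} (\<lambda>_. borel))))"
      using U_indep unfolding indep_rv_def by auto
    show "sets (sigma_gen (space M) borel U {1..}) \<subseteq> sets (vimage_algebra (space M) ?W (PiM {1..} (\<lambda>_. borel)))"
    proof (rule sets_sigma_gen_subset)
      fix i :: nat assume "i \<in> {1..}"
      with measurable_compose[OF W' measurable_component_singleton[of i]]
      show "U i \<in> borel_measurable (vimage_algebra (space M) ?W (PiM {1..} (\<lambda>_. borel)))" by simp
    qed simp
    show "sets (sigma_join (sigma_gen (space M) borel L {0..}) (sigma_gen (space M) (count_space UNIV) N {0..}))
      \<subseteq> sets (vimage_algebra (space M) ?V ?S)"
    proof (rule sets_sigma_join_least)
      show "sets (sigma_gen (space M) borel L {0..}) \<subseteq> sets (vimage_algebra (space M) ?V ?S)"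
      proof (rule sets_sigma_gen_subset)
        fix i :: real assume "i \<in> {0..}"
        with measurable_compose[OF measurable_compose[OF V' measurable_fst] measurable_component_singleton[of i]]
        show "L i \<in> borel_measurable (vimage_algebra (space M) ?V ?S)" by simp
      qed simp
      show "sets (sigma_gen (space M) (count_space UNIV) N {0..}) \<subseteq> sets (vimage_algebra (space M) ?V ?S)"
      proof (rule sets_sigma_gen_subset)
        fix i :: real assume "i \<in> {0..}"
        with measurable_compose[OF measurable_compose[OF V' measurable_snd] measurable_component_singleton[of i]]
        show "N i \<in> measurable (vimage_algebra (space M) ?V ?S) (count_space UNIV)" by simp
      qed simp
    qed simp_all
  qed
qed

lemma indep_NL_Y:
  "indep_set (sets (sigma_gen (space M) (count_space UNIV) NL {0..})) (sets (sigma_gen (space M) borel Y {1..}))"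
proof -
  let ?V = "\<lambda>\<omega>. \<lambda>t\<in>{0::real..}. NL t \<omega>"
  let ?W = "\<lambda>\<omega>. \<lambda>i\<in>{1..}. Y i \<omega>"
  have V: "?V \<in> space M \<rightarrow> space (PiM {0..} (\<lambda>_. count_space UNIV))"
    and W: "?W \<in> space M \<rightarrow> space (PiM {1..} (\<lambda>_. borel))"
    by (auto simp: space_PiM)
  note V' = measurable_vimage_algebra1[OF V] and W' = measurable_vimage_algebra1[OF W]
  show ?thesis
  proof (rule indep_set_mono)
    show "indep_set (sets (vimage_algebra (space M) ?V (PiM {0..} (\<lambda>_. count_space UNIV))))
       (sets (vimage_algebra (space M) ?W (PiM {1..} (\<lambda>_. borel))))"
      using NL_Y_indep unfolding indep_rv_def by auto
    show "sets (sigma_gen (space M) borel Y {1..}) \<subseteq> sets (vimage_algebra (space M) ?W (PiM {1..} (\<lambda>_. borel)))"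
    proof (rule sets_sigma_gen_subset)
      fix i :: nat assume "i \<in> {1..}"
      with measurable_compose[OF W' measurable_component_singleton[of i]]
      show "Y i \<in> borel_measurable (vimage_algebra (space M) ?W (PiM {1..} (\<lambda>_. borel)))" by simp
    qed simp
    show "sets (sigma_gen (space M) (count_space UNIV) NL {0..})
      \<subseteq> sets (vimage_algebra (space M) ?V (PiM {0..} (\<lambda>_. count_space UNIV)))"
    proof (rule sets_sigma_gen_subset)
      fix i :: real assume "i \<in> {0..}"
      with measurable_compose[OF V' measurable_component_singleton[of i]]
      show "NL i \<in> measurable (vimage_algebra (space M) ?V (PiM {0..} (\<lambda>_. count_space UNIV))) (count_space UNIV)" by simp
    qed simp
  qed
qed

lemma AE_Y_pos: "AE \<omega> in M. \<forall>i\<ge>1. 0 < Y i \<omega>"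
proof -
  have "AE \<omega> in M. 1 \<le> i \<longrightarrow> 0 < Y i \<omega>" for i
  proof (cases "1 \<le> i")
    case True
    then have d: "distr M borel (Y i) = \<nu>Y" using Y_iid unfolding iid_seq_def by auto
    have "AE y in distr M borel (Y i). 0 < y" unfolding d by (rule Y_pos)
    with AE_distrD[OF Y_measurable[OF True]] show ?thesis by auto
  qed simp
  then show ?thesis by (simp add: AE_all_countable)
qed

section \<open>The integrated intensity\<close>

lemma NL_mono: "\<omega> \<in> space M \<Longrightarrow> 0 \<le> s \<Longrightarrow> s \<le> t \<Longrightarrow> NL s \<omega> \<le> NL t \<omega>"
  by (rule counting_process_mono[OF NL_counting])

lemma N_mono: "\<omega> \<in> space M \<Longrightarrow> 0 \<le> s \<Longrightarrow> s \<le> t \<Longrightarrow> N s \<omega> \<le> N t \<omega>"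
  by (rule counting_process_mono[OF N_counting])

text \<open>Writes a sum with a random, time-dependent number of terms as a sum over the jumps up to a later
  time \<open>t\<close>, so that time enters only through the terms and the sum can be integrated term by term.\<close>

lemma sum_jumps_before:
  fixes f :: "nat \<Rightarrow> real"
  assumes "\<omega> \<in> space M" "0 \<le> v" "v \<le> t"
  shows "(\<Sum>i=1..NL v \<omega>. f i) = (\<Sum>i=1..NL t \<omega>. if jump_time NL i \<omega> \<le> v then f i else 0)"
proof -
  have "{1..NL v \<omega>} = {i \<in> {1..NL t \<omega>}. jump_time NL i \<omega> \<le> v}"
    using assms NL_mono[of \<omega> v t] jump_time_le_iff[OF NL_counting assms(1), of t _ v] by auto
  then show ?thesis by (simp only: sum.inter_filter[OF finite_atLeastAtMost])
qed

text \<open>The integrated form of \<open>dL = - \<delta> L dt + dJ\<close>, by linearity from the initial intensity, which behaves like a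
  shock at time \<open>0\<close>, and the individual shocks. Its right-hand side
  also shows that the integrated intensity is a random variable.\<close>

lemma integral_L:
  assumes \<omega>: "\<omega> \<in> space M" and ab: "0 \<le> a" "a \<le> b"
  shows "(LBINT v:{a..b}. L v \<omega>) = (L a \<omega> - L b \<omega> + J b \<omega> - J a \<omega>) / \<delta>"
proof -
  define T where "T i = jump_time NL i \<omega>" for i
  define G where "G i v = (if T i \<le> v then exp (- \<delta> * (v - T i)) else 0)" for i v
  define H where "H i v = (if T i \<le> v then 1 else 0 :: real)" for i v
  define G0 where "G0 v = (if 0 \<le> v then exp (- \<delta> * (v - 0)) else 0)" for v :: real
  let ?n = "NL b \<omega>"
  have L: "L v \<omega> = lam0 * G0 v + (\<Sum>i=1..?n. Y i \<omega> * G i v)" if "0 \<le> v" "v \<le> b" for v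
    unfolding shot_noise_def sum_jumps_before[OF \<omega> that] using that
    by (auto simp: G0_def G_def T_def intro!: sum.cong)
  have J: "J v \<omega> = (\<Sum>i=1..?n. Y i \<omega> * H i v)" if "0 \<le> v" "v \<le> b" for v
    unfolding J_def sum_jumps_before[OF \<omega> that] by (auto simp: H_def T_def intro!: sum.cong)
  have 1: "has_bochner_integral lborel (\<lambda>v. indicator {a..b} v *\<^sub>R G i v)
      ((G i a - G i b + H i b - H i a) / \<delta>)" for i
    using has_bochner_integral_exp_decay[OF ab(2) delta_pos, of "T i"] unfolding G_def H_def by simp
  have 0: "has_bochner_integral lborel (\<lambda>v. indicator {a..b} v *\<^sub>R G0 v) ((G0 a - G0 b) / \<delta>)"
    using has_bochner_integral_exp_decay[OF ab(2) delta_pos, of 0] ab unfolding G0_def by simp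
  have "has_bochner_integral lborel
      (\<lambda>v. lam0 * (indicator {a..b} v *\<^sub>R G0 v) + (\<Sum>i=1..?n. Y i \<omega> * (indicator {a..b} v *\<^sub>R G i v)))
      (lam0 * ((G0 a - G0 b) / \<delta>) + (\<Sum>i=1..?n. Y i \<omega> * ((G i a - G i b + H i b - H i a) / \<delta>)))"
    by (intro has_bochner_integral_add has_bochner_integral_sum has_bochner_integral_mult_right 0 1)
  moreover have "(\<lambda>v. lam0 * (indicator {a..b} v *\<^sub>R G0 v) + (\<Sum>i=1..?n. Y i \<omega> * (indicator {a..b} v *\<^sub>R G i v)))
     = (\<lambda>v. indicator {a..b} v *\<^sub>R L v \<omega>)"
    using ab by (auto simp: L indicator_def fun_eq_iff)
  moreover have "lam0 * ((G0 a - G0 b) / \<delta>) + (\<Sum>i=1..?n. Y i \<omega> * ((G i a - G i b + H i b - H i a) / \<delta>))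
     = (L a \<omega> - L b \<omega> + J b \<omega> - J a \<omega>) / \<delta>"
    using ab by (simp add: L J sum.distrib sum_subtractf sum_divide_distrib[symmetric] algebra_simps
        add_divide_distrib diff_divide_distrib)
  ultimately show ?thesis
    unfolding set_lebesgue_integral_def by (simp add: has_bochner_integral_integral_eq)
qed

lemma integral_L_nonneg:
  assumes "\<forall>i\<ge>1. 0 < Y i \<omega>"
  shows "0 \<le> (LBINT v:{a..b}. L v \<omega>)"
proof -
  have "0 \<le> L v \<omega>" for v
    unfolding shot_noise_def using assms lambda0_pos
    by (intro add_nonneg_nonneg sum_nonneg mult_nonneg_nonneg) (auto simp: less_imp_le)
  then show ?thesis
    unfolding set_lebesgue_integral_def by (intro Bochner_Integration.integral_nonneg) auto
qed

section \<open>Increments of the claim counting process given the intensity\<close>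

text \<open>The Cox property in integrated form: against any weight that depends on the intensity alone,
  an event about increments of \<open>N\<close> may be replaced by its conditional probability. The Poisson weights are
  nonnegative because almost surely all shocks are positive, so that the intensity and its integrals are nonnegative.\<close>

lemma nn_integral_N_increments:
  fixes f :: "'a \<Rightarrow> ennreal"
  assumes f: "f \<in> borel_measurable (sigma_gen (space M) borel L {0..})"
    and \<tau>: "0 \<le> \<tau> 0" "\<And>i. i < n \<Longrightarrow> \<tau> i \<le> \<tau> (Suc i)"
  shows "(\<integral>\<^sup>+\<omega>. f \<omega> * indicator {\<omega> \<in> space M. \<forall>i<n. N (\<tau> (Suc i)) \<omega> - N (\<tau> i) \<omega> = \<kappa> i} \<omega> \<partial>M)
    = (\<integral>\<^sup>+\<omega>. f \<omega> * (\<Prod>i<n. ennreal (poisson_weight (LBINT v:{\<tau> i..\<tau> (Suc i)}. L v \<omega>) (\<kappa> i))) \<partial>M)"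
    (is "(\<integral>\<^sup>+\<omega>. f \<omega> * indicator ?D \<omega> \<partial>M) = _")
proof -
  let ?F = "sigma_gen (space M) borel L {0..}"
  have sub: "subalgebra M ?F"
    unfolding subalgebra_def by (intro conjI sets_sigma_gen_subset L_measurable) simp_all
  interpret F: finite_measure_subalgebra M ?F
    using sub by unfold_locales
  have nonneg: "0 \<le> \<tau> i" if "i \<le> n" for i
    using that
  proof (induction i)
    case (Suc i)
    then show ?case using \<tau>(2)[of i] by simp
  qed (simp add: \<tau>)
  have "{\<omega> \<in> space M. \<forall>i\<in>{..<n}. N (\<tau> (Suc i)) \<omega> - N (\<tau> i) \<omega> = \<kappa> i} \<in> sets M"
  proof (rule sets.sets_Collect_finite_All)
    fix i assume "i \<in> {..<n}"
    then have [measurable]: "N (\<tau> (Suc i)) \<in> measurable M (count_space UNIV)"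
      "N (\<tau> i) \<in> measurable M (count_space UNIV)"
      using nonneg[of i] nonneg[of "Suc i"] by (simp_all add: N_measurable)
    show "{\<omega> \<in> space M. N (\<tau> (Suc i)) \<omega> - N (\<tau> i) \<omega> = \<kappa> i} \<in> sets M" by measurable
  qed simp
  then have D: "?D \<in> sets M" by (simp only: lessThan_iff Ball_def)
  have "(\<integral>\<^sup>+\<omega>. f \<omega> * indicator ?D \<omega> \<partial>M) = (\<integral>\<^sup>+\<omega>. f \<omega> * ennreal (real_cond_exp M ?F (indicator ?D) \<omega>) \<partial>M)"
    by (rule F.nn_integral_real_cond_exp_indicator[OF f D])
  also have "\<dots> = (\<integral>\<^sup>+\<omega>. f \<omega> * (\<Prod>i<n. ennreal (poisson_weight (LBINT v:{\<tau> i..\<tau> (Suc i)}. L v \<omega>) (\<kappa> i))) \<partial>M)"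
  proof (rule nn_integral_cong_AE)
    have "AE \<omega> in M. real_cond_exp M (generated_sigma M {0..} L) (indicator ?D) \<omega> =
        (\<Prod>i<n. poisson_weight (LBINT v:{\<tau> i..\<tau> (Suc i)}. L v \<omega>) (\<kappa> i))"
      using N_cox \<tau> unfolding cox_process_def poisson_weight_def Let_def by auto
    with AE_Y_pos show "AE \<omega> in M. f \<omega> * ennreal (real_cond_exp M ?F (indicator ?D) \<omega>) =
        f \<omega> * (\<Prod>i<n. ennreal (poisson_weight (LBINT v:{\<tau> i..\<tau> (Suc i)}. L v \<omega>) (\<kappa> i)))"
      unfolding generated_sigma_eq_sigma_gen
      by eventually_elim (simp add: prod_ennreal poisson_weight_nonneg integral_L_nonneg)
  qed
  finally show ?thesis .
qed

section \<open>Increments of the shocks given the past of the intensity\<close>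

lemma NL_increment_law:
  assumes st: "0 \<le> s" "s \<le> t"
  shows "(\<integral>\<^sup>+\<omega>. indicator {m} (NL t \<omega> - NL s \<omega>) \<partial>M) = ennreal (poisson_weight (\<rho> * (t - s)) m)"
proof (cases "s = t")
  case True
  then show ?thesis by (cases m) (simp_all add: poisson_weight_def emeasure_space_1)
next
  case False
  then have lt: "s < t" using st by simp
  have meas: "(\<lambda>\<omega>. NL t \<omega> - NL s \<omega>) \<in> measurable M (count_space UNIV)"
    using NL_measurable[OF st(1)] NL_measurable[OF order_trans[OF st]] by measurable
  have d: "distr M (count_space UNIV) (\<lambda>\<omega>. NL t \<omega> - NL s \<omega>) = measure_pmf (poisson_pmf (\<rho> * (t - s)))"
    using NL_poisson st lt unfolding poisson_process_def by auto
  have "(\<integral>\<^sup>+\<omega>. indicator {m} (NL t \<omega> - NL s \<omega>) \<partial>M)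
     = (\<integral>\<^sup>+x. indicator {m} x \<partial>distr M (count_space UNIV) (\<lambda>\<omega>. NL t \<omega> - NL s \<omega>))"
    by (rule nn_integral_distr[OF meas, symmetric]) simp
  also have "\<dots> = ennreal (pmf (poisson_pmf (\<rho> * (t - s))) m)"
    unfolding d by (simp add: emeasure_pmf_single)
  also have "pmf (poisson_pmf (\<rho> * (t - s))) m = poisson_weight (\<rho> * (t - s)) m"
    using rho_pos lt by (simp add: poisson_weight_def)
  finally show ?thesis .
qed

text \<open>Independence from the whole past rather than from finitely many increments: the past is
  generated by cylinders, which are countable unions of events about increments.\<close>

lemma indep_NL_increment:
  assumes st: "0 \<le> s" "s \<le> t"
  shows "indep_set (sets (sigma_gen (space M) (count_space UNIV) NL {0..s}))
    (sets (sigma_gen (space M) (count_space UNIV) (\<lambda>_::unit. \<lambda>\<omega>. NL t \<omega> - NL s \<omega>) UNIV))"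
proof -
  let ?I = "sigma_gen (space M) (count_space UNIV) (\<lambda>_::unit. \<lambda>\<omega>. NL t \<omega> - NL s \<omega>) UNIV"
  let ?C = "cylinders (space M) NL {0..s}"
  have meas: "(\<lambda>\<omega>. NL t \<omega> - NL s \<omega>) \<in> measurable M (count_space UNIV)"
    using NL_measurable[OF st(1)] NL_measurable[OF order_trans[OF st]] by measurable
  have I: "sets ?I \<subseteq> sets M" by (intro sets_sigma_gen_subset meas refl)
  have C: "?C \<subseteq> sets M" by (rule cylinders_subset_events) (simp add: NL_measurable)
  (* A cylinder becomes an event about increments once the value at s is fixed as well; the cases are summed up
     afterwards. *)
  have part: "emeasure M (D \<inter> {\<omega>. NL s \<omega> = k} \<inter> B) = emeasure M (D \<inter> {\<omega>. NL s \<omega> = k}) * emeasure M B"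
    if D: "D \<in> ?C" and B: "B \<in> sets ?I" for D B k
  proof (cases "D \<inter> {\<omega>. NL s \<omega> = k} = {}")
    case False
    obtain \<tau> n \<kappa> where \<tau>: "\<tau> 0 = 0" "\<forall>i<n. \<tau> i \<le> \<tau> (Suc i)" "\<tau> n = s"
      and eq: "D \<inter> {\<omega>. NL s \<omega> = k} = {\<omega> \<in> space M. \<forall>i<n. NL (\<tau> (Suc i)) \<omega> - NL (\<tau> i) \<omega> = \<kappa> i}"
      by (rule cylinder_as_increments[OF NL_counting st(1) D False]) blast
    (* One more interval, from s to t, is appended to the partition. *)
    define \<sigma> where "\<sigma> = \<tau>(Suc n := t)"
    define Z where "Z i \<omega> = NL (\<sigma> (Suc i)) \<omega> - NL (\<sigma> i) \<omega>" for i \<omega>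
    have "\<sigma> i \<le> \<sigma> (Suc i)" if "i < Suc n" for i
      using that \<tau> st unfolding \<sigma>_def by (auto simp: less_Suc_eq)
    moreover have "0 \<le> \<sigma> 0" using \<tau>(1) by (simp add: \<sigma>_def)
    ultimately have "indep_vars (\<lambda>_. count_space UNIV) (\<lambda>i \<omega>. NL (\<sigma> (Suc i)) \<omega> - NL (\<sigma> i) \<omega>) {..<Suc n}"
      using NL_poisson unfolding poisson_process_def by blast
    then have ind: "indep_vars (\<lambda>_. count_space UNIV) Z {..<Suc n}"
      by (simp add: Z_def[abs_def])
    have Zn: "Z n = (\<lambda>\<omega>. NL t \<omega> - NL s \<omega>)" using \<tau>(3) by (simp add: Z_def \<sigma>_def fun_eq_iff)
    have "indep_set (sets (sigma_gen (space M) (count_space UNIV) Z {..<n})) (sets (sigma_gen (space M) (count_space UNIV) Z {n}))"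
      by (rule indep_set_sigma_gen[OF ind]) auto
    moreover have "B \<in> sets (sigma_gen (space M) (count_space UNIV) Z {n})"
    proof -
      have "sets ?I \<subseteq> sets (sigma_gen (space M) (count_space UNIV) Z {n})"
        by (rule sets_sigma_gen_subset) (auto simp: Zn[symmetric] intro!: measurable_sigma_gen)
      then show ?thesis using B by auto
    qed
    moreover have "D \<inter> {\<omega>. NL s \<omega> = k} \<in> sets (sigma_gen (space M) (count_space UNIV) Z {..<n})" (is "_ \<in> sets ?H")
    proof -
      have "D \<inter> {\<omega>. NL s \<omega> = k} = {\<omega> \<in> space ?H. \<forall>i\<in>{..<n}. Z i \<omega> = \<kappa> i}"
        unfolding eq Z_def \<sigma>_def by auto
      also have "\<dots> \<in> sets ?H"
      proof (rule sets.sets_Collect_finite_All)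
        fix i assume "i \<in> {..<n}"
        then have "Z i \<in> measurable ?H (count_space UNIV)" by (intro measurable_sigma_gen) auto
        from measurable_sets[OF this, of "{\<kappa> i}"]
        show "{\<omega> \<in> space ?H. Z i \<omega> = \<kappa> i} \<in> sets ?H" by (simp add: vimage_def Int_def conj_commute)
      qed simp
      finally show ?thesis .
    qed
    ultimately have "prob (D \<inter> {\<omega>. NL s \<omega> = k} \<inter> B) = prob (D \<inter> {\<omega>. NL s \<omega> = k}) * prob B"
      by (intro indep_setD)
    then show ?thesis by (simp add: emeasure_eq_measure ennreal_mult'')
  next
    case True then show ?thesis by simp
  qed
  have "indep_set ?C (sets ?I)"
    unfolding indep_sets2_eq
  proof (intro conjI ballI C I)
    fix D B assume D: "D \<in> ?C" and B: "B \<in> sets ?I"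
    have DM: "D \<in> sets M" "B \<in> sets M" using D B C I by auto
    have split: "emeasure M A = (\<Sum>k. emeasure M (A \<inter> {\<omega>. NL s \<omega> = k}))" if "A \<in> sets M" for A
    proof -
      have AK: "A \<inter> {\<omega>. NL s \<omega> = k} \<in> sets M" for k
      proof -
        have "A \<inter> {\<omega>. NL s \<omega> = k} = A \<inter> (NL s -` {k} \<inter> space M)"
          using sets.sets_into_space[OF that] by auto
        then show ?thesis using that NL_measurable[OF st(1)] by (auto intro!: measurable_sets)
      qed
      have "emeasure M A = (\<integral>\<^sup>+\<omega>. indicator A \<omega> \<partial>M)" using that by simp
      also have "\<dots> = (\<Sum>k. \<integral>\<^sup>+\<omega>. indicator A \<omega> * indicator {k} (NL s \<omega>) \<partial>M)"
        using that NL_measurable[OF st(1)] by (intro nn_integral_split_nat) auto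
      also have "(\<lambda>k. \<integral>\<^sup>+\<omega>. indicator A \<omega> * indicator {k} (NL s \<omega>) \<partial>M)
          = (\<lambda>k. \<integral>\<^sup>+\<omega>. indicator (A \<inter> {\<omega>. NL s \<omega> = k}) \<omega> \<partial>M)"
        by (intro ext nn_integral_cong) (auto simp: indicator_def)
      finally show ?thesis using AK by simp
    qed
    have "emeasure M (D \<inter> B) = (\<Sum>k. emeasure M (D \<inter> B \<inter> {\<omega>. NL s \<omega> = k}))"
      using DM by (intro split) auto
    also have "\<dots> = (\<Sum>k. emeasure M (D \<inter> {\<omega>. NL s \<omega> = k}) * emeasure M B)"
      by (simp add: part[OF D B, symmetric] Int_ac)
    also have "\<dots> = emeasure M D * emeasure M B"
      unfolding split[OF DM(1)] by simp
    finally show "prob (D \<inter> B) = prob D * prob B"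
      by (simp add: emeasure_eq_measure ennreal_mult''[symmetric])
  qed
  then have "indep_set (sigma_sets (space M) ?C) (sigma_sets (space M) (sets ?I))"
    by (intro indep_set_sigma_sets Int_stable_cylinders) (auto simp: Int_stable_def)
  then show ?thesis
    by (rule indep_set_mono) (use sets_sigma_gen_cylinders in \<open>auto intro: sigma_sets.Basic\<close>)
qed

text \<open>What is known at time \<open>s\<close> on the event that \<open>j\<close> shocks have occurred.\<close>

definition shock_past :: "real \<Rightarrow> nat \<Rightarrow> 'a measure" where
  "shock_past s j = sigma_join (sigma_gen (space M) (count_space UNIV) NL {0..s}) (sigma_gen (space M) borel Y {1..j})"

definition intensity_past :: "real \<Rightarrow> 'a measure" where
  "intensity_past s = stratified (space M) (shock_past s) (NL s)"

lemma space_shock_past [simp]: "space (shock_past s j) = space M"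
  by (simp add: shock_past_def)

lemma NL_shock_past: "0 \<le> v \<Longrightarrow> v \<le> s \<Longrightarrow> NL v \<in> measurable (shock_past s j) (count_space UNIV)"
  unfolding shock_past_def
  by (rule measurable_sets_mono[OF measurable_sigma_gen[of v "{0..s}" NL "space M"]]) (auto simp: sets_sigma_join_upper)

lemma Y_shock_past: "1 \<le> i \<Longrightarrow> i \<le> j \<Longrightarrow> Y i \<in> borel_measurable (shock_past s j)"
  unfolding shock_past_def
  by (rule measurable_sets_mono[OF measurable_sigma_gen[of i "{1..j}" Y "space M"]]) (auto simp: sets_sigma_join_upper)

lemma stratum_shock_past:
  assumes "0 \<le> s" shows "{\<omega> \<in> space M. NL s \<omega> = k} \<in> sets (shock_past s j)"
  using measurable_sets[OF NL_shock_past[OF assms order_refl, of j], of "{k}"]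
  by (simp add: vimage_def Int_def conj_commute)

lemma sets_shock_past_subset: "sets (shock_past s j) \<subseteq> sets M"
  unfolding shock_past_def
  by (intro sets_sigma_join_least sets_sigma_gen_subset) (simp_all add: NL_measurable Y_measurable)

lemma sets_intensity_past_subset:
  assumes "0 \<le> s" shows "sets (intensity_past s) \<subseteq> sets M"
  unfolding intensity_past_def
  by (intro sets_stratified_subset space_shock_past stratum_shock_past assms sets_shock_past_subset)

lemma space_intensity_past [simp]: "space (intensity_past s) = space M"
  by (simp add: intensity_past_def)

text \<open>A jump time is known at time \<open>s\<close> only if the jump has occurred; otherwise it is replaced by the
  default value \<open>0\<close>.\<close>

lemma jump_time_shock_past:
  assumes s: "0 \<le> s"
  shows "(\<lambda>\<omega>. if i \<le> NL s \<omega> then jump_time NL i \<omega> else 0) \<in> borel_measurable (shock_past s j)"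
  unfolding borel_measurable_iff_le
proof
  fix a :: real
  show "{\<omega> \<in> space (shock_past s j). (if i \<le> NL s \<omega> then jump_time NL i \<omega> else 0) \<le> a} \<in> sets (shock_past s j)"
  proof (cases "0 \<le> a")
    case True
    have [measurable]: "NL (min a s) \<in> measurable (shock_past s j) (count_space UNIV)"
      "NL s \<in> measurable (shock_past s j) (count_space UNIV)"
      using True s by (auto intro!: NL_shock_past)
    have "(if i \<le> NL s \<omega> then jump_time NL i \<omega> else 0) \<le> a \<longleftrightarrow> i \<le> NL (min a s) \<omega> \<or> \<not> i \<le> NL s \<omega>"
      if "\<omega> \<in> space M" for \<omega>
      using jump_time_le_iff[OF NL_counting that s, of i "min a s"] jump_time_le_iff[OF NL_counting that s, of i s]
        True s by auto
    then have "{\<omega> \<in> space (shock_past s j). (if i \<le> NL s \<omega> then jump_time NL i \<omega> else 0) \<le> a}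
      = {\<omega> \<in> space (shock_past s j). i \<le> NL (min a s) \<omega> \<or> \<not> i \<le> NL s \<omega>}"
      unfolding space_shock_past by (intro Collect_cong conj_cong refl)
    also have "\<dots> \<in> sets (shock_past s j)" by measurable
    finally show ?thesis .
  next
    case False
    have "0 \<le> jump_time NL i \<omega>" if "i \<le> NL s \<omega>" for \<omega>
      unfolding jump_time_def using that s by (intro cInf_greatest) auto
    then have "{\<omega> \<in> space (shock_past s j). (if i \<le> NL s \<omega> then jump_time NL i \<omega> else 0) \<le> a} = {}"
      using False by (auto dest: order_trans)
    then show ?thesis by (simp only: sets.empty_sets)
  qed
qed

text \<open>On \<open>NL\<^sub>s = j\<close> the intensity up to \<open>s\<close> is a function of the first \<open>j\<close> shocks and of their
  times.\<close>

lemma L_intensity_past: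
  assumes v: "0 \<le> v" "v \<le> s"
  shows "L v \<in> borel_measurable (intensity_past s)"
  unfolding intensity_past_def
proof (rule measurable_stratifiedI)
  (* The default value in ?T is harmless: it is used only for i > NL s, where the summand vanishes. *)
  let ?T = "\<lambda>i \<omega>. if i \<le> NL s \<omega> then jump_time NL i \<omega> else 0"
  let ?g = "\<lambda>j \<omega>. lam0 * exp (- \<delta> * v)
    + (\<Sum>i=1..j. if i \<le> NL v \<omega> then Y i \<omega> * exp (- \<delta> * (v - ?T i \<omega>)) else 0)"
  have s: "0 \<le> s" using v by simp
  show "{\<omega> \<in> space M. NL s \<omega> = k} \<in> sets (shock_past s k)" for k
    by (rule stratum_shock_past[OF s])
  show "?g k \<in> borel_measurable (shock_past s k)" for k
  proof -
    have [measurable]: "NL v \<in> measurable (shock_past s k) (count_space UNIV)"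
      by (rule NL_shock_past[OF v])
    have [measurable]: "?T i \<in> borel_measurable (shock_past s k)" for i
      by (rule jump_time_shock_past[OF s])
    have [measurable]: "i \<in> {1..k} \<Longrightarrow> Y i \<in> borel_measurable (shock_past s k)" for i
      by (simp add: Y_shock_past)
    show ?thesis by measurable
  qed
  fix \<omega> assume \<omega>: "\<omega> \<in> space M"
  show "L v \<omega> = ?g (NL s \<omega>) \<omega>"
    unfolding shot_noise_def sum_count_extend[OF NL_counting \<omega> v]
    by (intro arg_cong2[of _ _ _ _ "(+)"] refl sum.cong) auto
qed simp

lemma J_intensity_past:
  assumes v: "0 \<le> v" "v \<le> s"
  shows "J v \<in> borel_measurable (intensity_past s)"
  unfolding intensity_past_def
proof (rule measurable_stratifiedI)
  let ?g = "\<lambda>j \<omega>. (\<Sum>i=1..j. if i \<le> NL v \<omega> then Y i \<omega> else 0)"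
  have s: "0 \<le> s" using v by simp
  show "{\<omega> \<in> space M. NL s \<omega> = k} \<in> sets (shock_past s k)" for k
    by (rule stratum_shock_past[OF s])
  show "?g k \<in> borel_measurable (shock_past s k)" for k
  proof -
    have [measurable]: "NL v \<in> measurable (shock_past s k) (count_space UNIV)"
      by (rule NL_shock_past[OF v])
    have [measurable]: "i \<in> {1..k} \<Longrightarrow> Y i \<in> borel_measurable (shock_past s k)" for i
      by (simp add: Y_shock_past)
    show ?thesis by measurable
  qed
  fix \<omega> assume \<omega>: "\<omega> \<in> space M"
  show "J v \<omega> = ?g (NL s \<omega>) \<omega>"
    unfolding J_def by (rule sum_count_extend[OF NL_counting \<omega> v])
qed simp

lemma J_measurable: "0 \<le> t \<Longrightarrow> J t \<in> borel_measurable M"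
  using measurable_sets_mono[OF J_intensity_past[of t t] _ sets_intensity_past_subset[of t]] by simp

lemma indep_shock_past_future:
  assumes st: "0 \<le> s" "s \<le> t"
  shows "indep_set (sets (shock_past s j))
    (sets (sigma_join (sigma_gen (space M) (count_space UNIV) (\<lambda>_::unit. \<lambda>\<omega>. NL t \<omega> - NL s \<omega>) UNIV)
       (sigma_gen (space M) borel Y {j<..})))"
  unfolding shock_past_def
proof (rule indep_set_sigma_join)
  let ?A = "sigma_gen (space M) (count_space UNIV) NL {0..}"
  have NLA: "NL v \<in> measurable ?A (count_space UNIV)" if "0 \<le> v" for v
    using that by (intro measurable_sigma_gen) auto
  have "(\<lambda>\<omega>. NL t \<omega> - NL s \<omega>) \<in> measurable ?A (count_space UNIV)"
    using NLA[OF st(1)] NLA[OF order_trans[OF st]] by measurable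
  then have A: "sets (sigma_join (sigma_gen (space M) (count_space UNIV) NL {0..s})
      (sigma_gen (space M) (count_space UNIV) (\<lambda>_::unit. \<lambda>\<omega>. NL t \<omega> - NL s \<omega>) UNIV)) \<subseteq> sets ?A"
    by (intro sets_sigma_join_least sigma_gen_mono sets_sigma_gen_subset) auto
  have B: "sets (sigma_join (sigma_gen (space M) borel Y {1..j}) (sigma_gen (space M) borel Y {j<..}))
      \<subseteq> sets (sigma_gen (space M) borel Y {1..})"
    by (intro sets_sigma_join_least sigma_gen_mono) auto
  show "indep_set (sets (sigma_join (sigma_gen (space M) (count_space UNIV) NL {0..s})
      (sigma_gen (space M) (count_space UNIV) (\<lambda>_::unit. \<lambda>\<omega>. NL t \<omega> - NL s \<omega>) UNIV)))
      (sets (sigma_join (sigma_gen (space M) borel Y {1..j}) (sigma_gen (space M) borel Y {j<..})))"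
    by (rule indep_set_mono[OF indep_NL_Y A B])
  show "indep_set (sets (sigma_gen (space M) borel Y {1..j})) (sets (sigma_gen (space M) borel Y {j<..}))"
    using Y_iid unfolding iid_seq_def by (intro indep_set_sigma_gen[where K="{1..}"]) auto
qed (simp_all add: indep_NL_increment[OF st])

text \<open>Independence of the increments of the compound Poisson process, together with their exponential
  moment. After fixing the number \<open>j\<close> of shocks before \<open>s\<close> and the number \<open>m\<close> between \<open>s\<close> and \<open>t\<close>, the
  increment is a sum of the \<open>m\<close> shocks after the \<open>j\<close>-th, which are independent of the past; summation over
  \<open>m\<close> is the Poisson generating function.\<close>

lemma nn_integral_J_increment:
  fixes \<Psi> :: "'a \<Rightarrow> ennreal"
  assumes st: "0 \<le> s" "s \<le> t"
    and \<Psi>: "\<Psi> \<in> borel_measurable (intensity_past s)"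
    and a: "integrable \<nu>Y (\<lambda>y. exp (a * y))"
  shows "(\<integral>\<^sup>+\<omega>. \<Psi> \<omega> * ennreal (exp (a * (J t \<omega> - J s \<omega>))) \<partial>M)
    = (\<integral>\<^sup>+\<omega>. \<Psi> \<omega> \<partial>M) * ennreal (exp ((mgf \<nu>Y a - 1) * (\<rho> * (t - s))))"
proof -
  have t: "0 \<le> t" using st by simp
  let ?I = "sigma_gen (space M) (count_space UNIV) (\<lambda>_::unit. \<lambda>\<omega>. NL t \<omega> - NL s \<omega>) UNIV"
  have [measurable]: "\<Psi> \<in> borel_measurable M"
    by (rule measurable_sets_mono[OF \<Psi>]) (simp_all add: sets_intensity_past_subset st)
  have [measurable]: "J t \<in> borel_measurable M" "J s \<in> borel_measurable M"
    using J_measurable st t by auto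
  have NLs: "NL s \<in> measurable M (count_space UNIV)" by (rule NL_measurable[OF st(1)])
  have NLts: "(\<lambda>\<omega>. NL t \<omega> - NL s \<omega>) \<in> measurable M (count_space UNIV)"
    using NLs NL_measurable[OF t] by measurable
  have ind_meas [measurable]: "(\<lambda>\<omega>. indicator {j} (NL s \<omega>) :: ennreal) \<in> borel_measurable M" for j
    by (rule measurable_compose[OF NLs]) simp
  let ?e = "\<lambda>\<omega>. ennreal (exp (a * (J t \<omega> - J s \<omega>)))"
  let ?q = "ennreal (mgf \<nu>Y a)"
  let ?p = "\<lambda>m. ennreal (poisson_weight (\<rho> * (t - s)) m)"
  have piece: "(\<integral>\<^sup>+\<omega>. \<Psi> \<omega> * ?e \<omega> * indicator {j} (NL s \<omega>) * indicator {m} (NL t \<omega> - NL s \<omega>) \<partial>M)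
      = (\<integral>\<^sup>+\<omega>. \<Psi> \<omega> * indicator {j} (NL s \<omega>) \<partial>M) * (?p m * ?q ^ m)" for j m
  proof -
    let ?R = "\<lambda>\<omega>. indicator {m} (NL t \<omega> - NL s \<omega>) :: ennreal"
    let ?P = "\<lambda>\<omega>. \<Prod>i\<in>{j<..j+m}. ennreal (exp (a * Y i \<omega>))"
    have R: "?R \<in> borel_measurable ?I"
      by (rule measurable_compose[OF measurable_sigma_gen[of "()"]]) auto
    have P: "?P \<in> borel_measurable (sigma_gen (space M) borel Y {j<..})"
    proof (rule borel_measurable_prod_ennreal)
      fix i assume "i \<in> {j<..j+m}"
      then have [measurable]: "Y i \<in> borel_measurable (sigma_gen (space M) borel Y {j<..})"
        by (intro measurable_sigma_gen) auto
      show "(\<lambda>\<omega>. ennreal (exp (a * Y i \<omega>))) \<in> borel_measurable (sigma_gen (space M) borel Y {j<..})"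
        by measurable
    qed
    have "\<Psi> \<omega> * ?e \<omega> * indicator {j} (NL s \<omega>) * ?R \<omega> = (\<Psi> \<omega> * indicator {j} (NL s \<omega>)) * (?R \<omega> * ?P \<omega>)"
      if \<omega>: "\<omega> \<in> space M" for \<omega>
    proof (cases "NL s \<omega> = j \<and> NL t \<omega> - NL s \<omega> = m")
      case True
      then have n: "NL s \<omega> = j" "NL t \<omega> = j + m" using NL_mono[OF \<omega> st] by auto
      have "{1..j+m} = {1..j} \<union> {j<..j+m}" by auto
      then have "(\<Sum>i=1..j+m. Y i \<omega>) = (\<Sum>i=1..j. Y i \<omega>) + (\<Sum>i\<in>{j<..j+m}. Y i \<omega>)"
        by (simp only:) (rule sum.union_disjoint, auto)
      then have "J t \<omega> - J s \<omega> = (\<Sum>i\<in>{j<..j+m}. Y i \<omega>)"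
        unfolding J_def n by simp
      then have "?e \<omega> = ?P \<omega>"
        by (simp add: prod_ennreal exp_sum sum_distrib_left)
      then show ?thesis by (simp add: n)
    next
      case False
      then show ?thesis by (cases "NL s \<omega> = j") auto
    qed
    then have "(\<integral>\<^sup>+\<omega>. \<Psi> \<omega> * ?e \<omega> * indicator {j} (NL s \<omega>) * ?R \<omega> \<partial>M)
        = (\<integral>\<^sup>+\<omega>. (\<Psi> \<omega> * indicator {j} (NL s \<omega>)) * (?R \<omega> * ?P \<omega>) \<partial>M)"
      by (intro nn_integral_cong)
    also have "\<dots> = (\<integral>\<^sup>+\<omega>. \<Psi> \<omega> * indicator {j} (NL s \<omega>) \<partial>M) * (\<integral>\<^sup>+\<omega>. ?R \<omega> * ?P \<omega> \<partial>M)"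
    proof (rule nn_integral_indep_mult[OF indep_shock_past_future[OF st, of j]])
      show "(\<lambda>\<omega>. \<Psi> \<omega> * indicator {j} (NL s \<omega>)) \<in> borel_measurable (shock_past s j)"
        by (rule measurable_on_stratum[OF space_shock_past stratum_shock_past[OF st(1)]
            \<Psi>[unfolded intensity_past_def]])
      have "?R \<in> borel_measurable (sigma_join ?I (sigma_gen (space M) borel Y {j<..}))"
        by (rule measurable_sets_mono[OF R]) (simp_all add: sets_sigma_join_upper)
      moreover have "?P \<in> borel_measurable (sigma_join ?I (sigma_gen (space M) borel Y {j<..}))"
        by (rule measurable_sets_mono[OF P]) (simp_all add: sets_sigma_join_upper)
      ultimately show "(\<lambda>\<omega>. ?R \<omega> * ?P \<omega>) \<in> borel_measurable (sigma_join ?I (sigma_gen (space M) borel Y {j<..}))"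
        by (rule borel_measurable_times_ennreal)
    qed simp_all
    also have "(\<integral>\<^sup>+\<omega>. ?R \<omega> * ?P \<omega> \<partial>M) = (\<integral>\<^sup>+\<omega>. ?R \<omega> \<partial>M) * (\<integral>\<^sup>+\<omega>. ?P \<omega> \<partial>M)"
    proof (rule nn_integral_indep_mult[OF _ _ _ R P])
      let ?A = "sigma_gen (space M) (count_space UNIV) NL {0..}"
      have NLA: "NL v \<in> measurable ?A (count_space UNIV)" if "0 \<le> v" for v
        using that by (intro measurable_sigma_gen) auto
      have "(\<lambda>\<omega>. NL t \<omega> - NL s \<omega>) \<in> measurable ?A (count_space UNIV)"
        using NLA[OF st(1)] NLA[OF t] by measurable
      then show "indep_set (sets ?I) (sets (sigma_gen (space M) borel Y {j<..}))"
        by (intro indep_set_mono[OF indep_NL_Y] sigma_gen_mono sets_sigma_gen_subset) auto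
    qed simp_all
    also have "(\<integral>\<^sup>+\<omega>. ?R \<omega> \<partial>M) = ?p m" by (rule NL_increment_law[OF st])
    also have "(\<integral>\<^sup>+\<omega>. ?P \<omega> \<partial>M) = ?q ^ m"
      using nn_integral_prod_iid[OF Y_iid, of "\<lambda>y. ennreal (exp (a * y))" "{j<..j+m}"]
      by (simp add: nn_integral_exp_eq_mgf[OF a] subset_eq)
    finally show ?thesis .
  qed
  have "(\<integral>\<^sup>+\<omega>. \<Psi> \<omega> * ?e \<omega> \<partial>M) = (\<Sum>j. \<integral>\<^sup>+\<omega>. \<Psi> \<omega> * ?e \<omega> * indicator {j} (NL s \<omega>) \<partial>M)"
    by (rule nn_integral_split_nat[OF _ NLs]) measurable
  also have "\<dots> = (\<Sum>j. \<Sum>m. \<integral>\<^sup>+\<omega>. \<Psi> \<omega> * ?e \<omega> * indicator {j} (NL s \<omega>) * indicator {m} (NL t \<omega> - NL s \<omega>) \<partial>M)"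
    by (intro suminf_cong nn_integral_split_nat[OF _ NLts]) measurable
  also have "\<dots> = (\<Sum>j. (\<integral>\<^sup>+\<omega>. \<Psi> \<omega> * indicator {j} (NL s \<omega>) \<partial>M) * (\<Sum>m. ?p m * ?q ^ m))"
    by (simp only: piece ennreal_suminf_cmult)
  also have "(\<Sum>m. ?p m * ?q ^ m) = ennreal (exp ((mgf \<nu>Y a - 1) * (\<rho> * (t - s))))"
    using rho_pos st by (intro poisson_weight_pgf mgf_nonneg) auto
  also have "(\<Sum>j. (\<integral>\<^sup>+\<omega>. \<Psi> \<omega> * indicator {j} (NL s \<omega>) \<partial>M) * ennreal (exp ((mgf \<nu>Y a - 1) * (\<rho> * (t - s)))))
    = (\<integral>\<^sup>+\<omega>. \<Psi> \<omega> \<partial>M) * ennreal (exp ((mgf \<nu>Y a - 1) * (\<rho> * (t - s))))"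
    by (subst nn_integral_split_nat[OF _ NLs, of \<Psi>]) (simp_all add: ennreal_suminf_multc)
  finally show ?thesis .
qed

section \<open>The past of the surplus and the intensity\<close>

text \<open>What is known at time \<open>s\<close> on the event that \<open>k\<close> claims have occurred.\<close>

definition claim_past :: "real \<Rightarrow> nat \<Rightarrow> 'a measure" where
  "claim_past s k = sigma_join (sigma_join (sigma_gen (space M) (count_space UNIV) N {0..s}) (sigma_gen (space M) borel L {0..s}))
     (sigma_gen (space M) borel U {1..k})"

definition surplus_past :: "real \<Rightarrow> 'a measure" where
  "surplus_past s = stratified (space M) (claim_past s) (N s)"

lemma space_claim_past [simp]: "space (claim_past s k) = space M"
  by (simp add: claim_past_def)

lemma space_surplus_past [simp]: "space (surplus_past s) = space M"
  by (simp add: surplus_past_def)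

lemma sets_claim_past_upper:
  "sets (sigma_gen (space M) (count_space UNIV) N {0..s}) \<subseteq> sets (claim_past s k)"
  "sets (sigma_gen (space M) borel L {0..s}) \<subseteq> sets (claim_past s k)"
  "sets (sigma_gen (space M) borel U {1..k}) \<subseteq> sets (claim_past s k)"
  unfolding claim_past_def
  by (intro order_trans[OF sets_sigma_join_upper(1) sets_sigma_join_upper(1)]
      order_trans[OF sets_sigma_join_upper(2) sets_sigma_join_upper(1)] sets_sigma_join_upper(2); simp)+

lemma N_claim_past: "0 \<le> v \<Longrightarrow> v \<le> s \<Longrightarrow> N v \<in> measurable (claim_past s k) (count_space UNIV)"
  by (rule measurable_sets_mono[OF measurable_sigma_gen[of v "{0..s}" N "space M"] _ sets_claim_past_upper(1)]) auto

lemma L_claim_past: "0 \<le> v \<Longrightarrow> v \<le> s \<Longrightarrow> L v \<in> borel_measurable (claim_past s k)"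
  by (rule measurable_sets_mono[OF measurable_sigma_gen[of v "{0..s}" L "space M"] _ sets_claim_past_upper(2)]) auto

lemma U_claim_past: "1 \<le> i \<Longrightarrow> i \<le> k \<Longrightarrow> U i \<in> borel_measurable (claim_past s k)"
  by (rule measurable_sets_mono[OF measurable_sigma_gen[of i "{1..k}" U "space M"] _ sets_claim_past_upper(3)]) auto

lemma stratum_claim_past:
  assumes "0 \<le> s" shows "{\<omega> \<in> space M. N s \<omega> = j} \<in> sets (claim_past s k)"
  using measurable_sets[OF N_claim_past[OF assms order_refl, of k], of "{j}"]
  by (simp add: vimage_def Int_def conj_commute)

lemma sets_claim_past_subset: "sets (claim_past s k) \<subseteq> sets M"
  unfolding claim_past_def
  by (intro sets_sigma_join_least sets_sigma_gen_subset) (simp_all add: N_measurable L_measurable U_measurable)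

lemma sets_surplus_past_subset:
  assumes "0 \<le> s" shows "sets (surplus_past s) \<subseteq> sets M"
  unfolding surplus_past_def
  by (intro sets_stratified_subset space_claim_past stratum_claim_past assms sets_claim_past_subset)

lemma L_surplus_past:
  assumes v: "0 \<le> v" "v \<le> s"
  shows "L v \<in> borel_measurable (surplus_past s)"
  unfolding surplus_past_def
  by (rule measurable_stratifiedI[where g="\<lambda>_. L v"])
    (use v in \<open>auto intro!: stratum_claim_past L_claim_past\<close>)

lemma X_surplus_past:
  assumes v: "0 \<le> v" "v \<le> s"
  shows "X v \<in> borel_measurable (surplus_past s)"
  unfolding surplus_past_def
proof (rule measurable_stratifiedI)
  let ?g = "\<lambda>k \<omega>. u + c * v - (\<Sum>i=1..k. if i \<le> N v \<omega> then U i \<omega> else 0)"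
  have s: "0 \<le> s" using v by simp
  show "{\<omega> \<in> space M. N s \<omega> = k} \<in> sets (claim_past s k)" for k
    by (rule stratum_claim_past[OF s])
  show "?g k \<in> borel_measurable (claim_past s k)" for k
  proof -
    have [measurable]: "N v \<in> measurable (claim_past s k) (count_space UNIV)"
      by (rule N_claim_past[OF v])
    have [measurable]: "i \<in> {1..k} \<Longrightarrow> U i \<in> borel_measurable (claim_past s k)" for i
      by (simp add: U_claim_past)
    show ?thesis by measurable
  qed
  fix \<omega> assume \<omega>: "\<omega> \<in> space M"
  show "X v \<omega> = ?g (N s \<omega>) \<omega>"
    unfolding surplus_def by (simp only: sum_count_extend[OF N_counting \<omega> v])
qed simp

end

section \<open>The martingale identity on the past\<close>

locale exponential_tilt = shot_noise_risk_model +
  fixes r \<alpha> \<theta> :: real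
  assumes exp_U: "integrable \<nu>U (\<lambda>x. exp (r * x))"
    and alpha: "\<alpha> = (1 - mgf \<nu>U r) / \<delta>"
    and exp_Y: "integrable \<nu>Y (\<lambda>y. exp (- \<alpha> * y))"
    and theta: "\<theta> = - c * r + \<rho> * (mgf \<nu>Y (- \<alpha>) - 1)"
begin

text \<open>The process \<open>M\<^sup>r\<close>, as a function of time and outcome.\<close>

definition tilt :: "real \<Rightarrow> 'a \<Rightarrow> real" where
  "tilt t \<omega> = exp (r * u + \<alpha> * lam0) * exp (- \<theta> * t - \<alpha> * L t \<omega> - r * X t \<omega>)"

lemma tilt_nonneg: "0 \<le> tilt t \<omega>"
  by (simp add: tilt_def)

lemma tilt_surplus_past:
  assumes "0 \<le> v" "v \<le> s" shows "tilt v \<in> borel_measurable (surplus_past s)"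
proof -
  note [measurable] = X_surplus_past[OF assms] L_surplus_past[OF assms]
  show ?thesis unfolding tilt_def[abs_def] by measurable
qed

lemma tilt_measurable: "0 \<le> t \<Longrightarrow> tilt t \<in> borel_measurable M"
  using measurable_sets_mono[OF tilt_surplus_past[of t t] _ sets_surplus_past_subset[of t]] by simp

text \<open>The heart of the proof. The integral is evaluated as a product of a factor for the known claims, a
  factor for the past of the intensity and a deterministic exponential, and the point is that the result does not
  involve \<open>t\<close>. Stating it in this way covers \<open>t = s\<close> as well, so that the two sides of the martingale identity need
  not be computed separately.\<close>

lemma nn_integral_tilt_cylinder:
  assumes s: "0 \<le> s" and D: "D \<in> cylinders (space M) N {0..s}"
    and a: "a \<in> sets (sigma_gen (space M) borel L {0..s})"
    and b: "b \<in> sets (sigma_gen (space M) borel U {1..k})"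
  obtains V where "\<And>t. s \<le> t \<Longrightarrow>
    (\<integral>\<^sup>+\<omega>. ennreal (tilt t \<omega>) * indicator {k} (N s \<omega>) * indicator (D \<inter> a \<inter> b) \<omega> \<partial>M) = V"
proof (cases "D \<inter> {\<omega>. N s \<omega> = k} = {}")
  case True
  then have zero: "ennreal (tilt t \<omega>) * indicator {k} (N s \<omega>) * indicator (D \<inter> a \<inter> b) \<omega> = 0" for t \<omega>
    by (auto simp: indicator_def)
  show ?thesis by (rule that[of 0]) (unfold zero, simp)
next
  case False
  obtain \<tau> n \<kappa> where \<tau>: "\<tau> 0 = 0" "\<forall>i<n. \<tau> i \<le> \<tau> (Suc i)" "\<tau> n = s"
    and eq: "D \<inter> {\<omega>. N s \<omega> = k} = {\<omega> \<in> space M. \<forall>i<n. N (\<tau> (Suc i)) \<omega> - N (\<tau> i) \<omega> = \<kappa> i}"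
    by (rule cylinder_as_increments[OF N_counting s D False]) blast
  have \<tau>0: "0 \<le> \<tau> i" if "i \<le> n" for i
    using that
  proof (induction i)
    case (Suc i)
    then show ?case using \<tau>(2)[rule_format, of i] by simp
  qed (simp add: \<tau>)
  have \<tau>s: "\<tau> i \<le> s" if "i \<le> n" for i
    using that
  proof (induction rule: inc_induct)
    case (step i)
    then show ?case using \<tau>(2)[rule_format, of i] by simp
  qed (simp add: \<tau>)
  let ?\<mu> = "\<lambda>v w \<omega>. (L v \<omega> - L w \<omega> + J w \<omega> - J v \<omega>) / \<delta>"
  (* \<Phi> is the conditional probability, given the intensity, of the cylinder D together with N s = k; \<Psi> collects
     what the past of the intensity contributes, FU what the first k claims contribute. *)
  define \<Phi> where "\<Phi> \<omega> = (\<Prod>i<n. ennreal (poisson_weight (?\<mu> (\<tau> i) (\<tau> (Suc i)) \<omega>) (\<kappa> i)))" for \<omega>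
  define \<Psi> where "\<Psi> \<omega> = ennreal (exp (- \<alpha> * L s \<omega>)) * indicator a \<omega> * \<Phi> \<omega>" for \<omega>
  define FU :: "'a \<Rightarrow> ennreal" where "FU \<omega> = indicator b \<omega> * (\<Prod>i\<in>{1..k}. ennreal (exp (r * U i \<omega>)))" for \<omega>
  have a_past: "a \<in> sets (intensity_past s)"
  proof -
    have "sets (sigma_gen (space M) borel L {0..s}) \<subseteq> sets (intensity_past s)"
      by (intro sets_sigma_gen_subset) (auto intro!: L_intensity_past)
    then show ?thesis using a by auto
  qed
  have \<Phi>_past: "\<Phi> \<in> borel_measurable (intensity_past s)"
    unfolding \<Phi>_def[abs_def]
  proof (rule borel_measurable_prod_ennreal)
    fix i assume i: "i \<in> {..<n}"
    note [measurable] = L_intensity_past[of "\<tau> i" s] L_intensity_past[of "\<tau> (Suc i)" s]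
      J_intensity_past[of "\<tau> i" s] J_intensity_past[of "\<tau> (Suc i)" s]
    have [simp]: "0 \<le> \<tau> i" "\<tau> i \<le> s" "0 \<le> \<tau> (Suc i)" "\<tau> (Suc i) \<le> s"
      using i \<tau>0[of i] \<tau>s[of i] \<tau>0[of "Suc i"] \<tau>s[of "Suc i"] by simp_all
    show "(\<lambda>\<omega>. ennreal (poisson_weight (?\<mu> (\<tau> i) (\<tau> (Suc i)) \<omega>) (\<kappa> i))) \<in> borel_measurable (intensity_past s)"
      by measurable
  qed
  have \<Psi>_past: "\<Psi> \<in> borel_measurable (intensity_past s)"
  proof -
    note [measurable] = L_intensity_past[OF s order_refl] \<Phi>_past a_past
    show ?thesis unfolding \<Psi>_def[abs_def] by measurable
  qed
  have aM [measurable]: "a \<in> sets M" using a_past sets_intensity_past_subset[OF s] by auto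
  have \<Phi>M [measurable]: "\<Phi> \<in> borel_measurable M"
    by (rule measurable_sets_mono[OF \<Phi>_past]) (simp_all add: sets_intensity_past_subset s)
  have FU: "FU \<in> borel_measurable (sigma_gen (space M) borel U {1..k})"
  proof -
    have [measurable]: "i \<in> {1..k} \<Longrightarrow> U i \<in> borel_measurable (sigma_gen (space M) borel U {1..k})" for i
      by (intro measurable_sigma_gen) auto
    note [measurable] = b
    show ?thesis unfolding FU_def[abs_def] by measurable
  qed
  have bM [measurable]: "b \<in> sets M"
    using sets_claim_past_upper(3) sets_claim_past_subset b by blast
  let ?q = "ennreal (mgf \<nu>U r)"
  show ?thesis
  proof (rule that)
    fix t assume st: "s \<le> t"
    have t: "0 \<le> t" using s st by simp
    let ?C = "\<lambda>t. ennreal (exp (\<alpha> * lam0 - \<theta> * t - r * c * t))"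
    have Nts: "(\<lambda>\<omega>. N t \<omega> - N s \<omega>) \<in> measurable M (count_space UNIV)"
      using N_measurable[OF s] N_measurable[OF t] by measurable
    note [measurable] = tilt_measurable[OF t] L_measurable[OF s] L_measurable[OF t] J_measurable[OF s] J_measurable[OF t]
    have [measurable]: "D \<in> sets M"
      using cylinders_subset_events[of "{0..s}" N] D N_measurable by auto
    have [measurable]: "(\<lambda>\<omega>. indicator {k} (N s \<omega>) :: ennreal) \<in> borel_measurable M"
      by (rule measurable_compose[OF N_measurable[OF s]]) simp
    let ?E = "\<lambda>\<omega>. ennreal (exp (- \<alpha> * L t \<omega>)) * indicator a \<omega>"
    (* With exactly m claims between s and t the number of claims is no longer random, so the integrand is a
       product of a function of (L, N) and a function of the claims U. *)
    have piece: "(\<integral>\<^sup>+\<omega>. ennreal (tilt t \<omega>) * indicator {k} (N s \<omega>) * indicator (D \<inter> a \<inter> b) \<omega>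
        * indicator {m} (N t \<omega> - N s \<omega>) \<partial>M)
      = ?C t * (\<integral>\<^sup>+\<omega>. FU \<omega> \<partial>M) * (\<integral>\<^sup>+\<omega>. ?E \<omega> * \<Phi> \<omega> * (ennreal (poisson_weight (?\<mu> s t \<omega>) m) * ?q ^ m) \<partial>M)" for m
    proof -
      define \<sigma> where "\<sigma> = \<tau>(Suc n := t)"
      define \<kappa>' where "\<kappa>' = \<kappa>(n := m)"
      have \<sigma>: "0 \<le> \<sigma> 0" "\<And>i. i < Suc n \<Longrightarrow> \<sigma> i \<le> \<sigma> (Suc i)"
        using \<tau> st unfolding \<sigma>_def by (auto simp: less_Suc_eq)
      define D' where "D' = {\<omega> \<in> space M. \<forall>i<Suc n. N (\<sigma> (Suc i)) \<omega> - N (\<sigma> i) \<omega> = \<kappa>' i}"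
      have D': "D' = D \<inter> {\<omega>. N s \<omega> = k} \<inter> {\<omega>. N t \<omega> - N s \<omega> = m}"
        unfolding eq D'_def \<sigma>_def \<kappa>'_def using \<tau>(3) by (auto simp: less_Suc_eq)
      let ?P = "\<lambda>\<omega>. \<Prod>i\<in>{k<..k+m}. ennreal (exp (r * U i \<omega>))"
      have "ennreal (tilt t \<omega>) * indicator {k} (N s \<omega>) * indicator (D \<inter> a \<inter> b) \<omega> * indicator {m} (N t \<omega> - N s \<omega>)
        = ?C t * ((?E \<omega> * indicator D' \<omega>) * (FU \<omega> * ?P \<omega>))" if \<omega>: "\<omega> \<in> space M" for \<omega>
      proof (cases "\<omega> \<in> D' \<and> \<omega> \<in> a \<and> \<omega> \<in> b")
        case True
        then have n: "N s \<omega> = k" "N t \<omega> = k + m" using N_mono[OF \<omega> s st] unfolding D' by auto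
        have "{1..k+m} = {1..k} \<union> {k<..k+m}" by auto
        then have "(\<Sum>i=1..k+m. U i \<omega>) = (\<Sum>i=1..k. U i \<omega>) + (\<Sum>i\<in>{k<..k+m}. U i \<omega>)"
          by (simp only:) (rule sum.union_disjoint, auto)
        then have "tilt t \<omega> = exp (\<alpha> * lam0 - \<theta> * t - r * c * t) * (exp (- \<alpha> * L t \<omega>) *
            (exp (r * (\<Sum>i=1..k. U i \<omega>)) * exp (r * (\<Sum>i\<in>{k<..k+m}. U i \<omega>))))"
          unfolding tilt_def surplus_def n by (simp add: exp_add[symmetric] algebra_simps)
        also have "exp (r * (\<Sum>i=1..k. U i \<omega>)) = (\<Prod>i=1..k. exp (r * U i \<omega>))"
          by (simp add: exp_sum sum_distrib_left)
        also have "exp (r * (\<Sum>i\<in>{k<..k+m}. U i \<omega>)) = (\<Prod>i\<in>{k<..k+m}. exp (r * U i \<omega>))"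
          by (simp add: exp_sum sum_distrib_left)
        finally have "ennreal (tilt t \<omega>) = ?C t * (ennreal (exp (- \<alpha> * L t \<omega>)) *
            ((\<Prod>i=1..k. ennreal (exp (r * U i \<omega>))) * ?P \<omega>))"
          by (simp add: ennreal_mult'' prod_nonneg prod_ennreal)
        then show ?thesis using True n by (simp add: FU_def D')
      next
        case False
        then show ?thesis using \<omega> by (auto simp: FU_def D' indicator_def)
      qed
      then have "(\<integral>\<^sup>+\<omega>. ennreal (tilt t \<omega>) * indicator {k} (N s \<omega>) * indicator (D \<inter> a \<inter> b) \<omega>
          * indicator {m} (N t \<omega> - N s \<omega>) \<partial>M)
        = (\<integral>\<^sup>+\<omega>. ?C t * ((?E \<omega> * indicator D' \<omega>) * (FU \<omega> * ?P \<omega>)) \<partial>M)"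
        by (intro nn_integral_cong)
      also have "\<dots> = ?C t * (\<integral>\<^sup>+\<omega>. (?E \<omega> * indicator D' \<omega>) * (FU \<omega> * ?P \<omega>) \<partial>M)"
      proof (rule nn_integral_cmult)
        have [measurable]: "D' \<in> sets M"
        proof -
          have "D' = (D \<inter> {\<omega> \<in> space M. N s \<omega> = k}) \<inter> {\<omega> \<in> space M. N t \<omega> - N s \<omega> = m}"
            unfolding D' using sets.sets_into_space[OF \<open>D \<in> sets M\<close>] by auto
          also have "\<dots> \<in> sets M"
            using N_measurable[OF s] Nts by measurable
          finally show ?thesis .
        qed
        have [measurable]: "i \<in> {k<..k+m} \<Longrightarrow> U i \<in> borel_measurable M" for i
          by (simp add: U_measurable)
        have [measurable]: "FU \<in> borel_measurable M"
          by (rule measurable_sets_mono[OF FU space_sigma_gen], rule sets_sigma_gen_subset) (simp_all add: U_measurable)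
        show "(\<lambda>\<omega>. (?E \<omega> * indicator D' \<omega>) * (FU \<omega> * ?P \<omega>)) \<in> borel_measurable M" by measurable
      qed
      also have "(\<integral>\<^sup>+\<omega>. (?E \<omega> * indicator D' \<omega>) * (FU \<omega> * ?P \<omega>) \<partial>M)
          = (\<integral>\<^sup>+\<omega>. ?E \<omega> * indicator D' \<omega> \<partial>M) * (\<integral>\<^sup>+\<omega>. FU \<omega> * ?P \<omega> \<partial>M)"
      proof (rule nn_integral_indep_mult[OF indep_L_N_U])
        let ?LN = "sigma_join (sigma_gen (space M) borel L {0..}) (sigma_gen (space M) (count_space UNIV) N {0..})"
        have LLN: "L v \<in> borel_measurable ?LN" if "0 \<le> v" for v
          by (rule measurable_sets_mono[OF measurable_sigma_gen[of v "{0..}" L "space M"]])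
            (use that in \<open>auto simp: sets_sigma_join_upper\<close>)
        have NLN: "N v \<in> measurable ?LN (count_space UNIV)" if "0 \<le> v" for v
          by (rule measurable_sets_mono[OF measurable_sigma_gen[of v "{0..}" N "space M"]])
            (use that in \<open>auto simp: sets_sigma_join_upper\<close>)
        have [measurable]: "L t \<in> borel_measurable ?LN" by (rule LLN[OF t])
        have "sets (sigma_gen (space M) borel L {0..s}) \<subseteq> sets ?LN"
          by (intro sets_sigma_gen_subset) (auto intro!: LLN)
        then have [measurable]: "a \<in> sets ?LN" using a by auto
        have "{\<omega> \<in> space ?LN. \<forall>i\<in>{..<Suc n}. N (\<sigma> (Suc i)) \<omega> - N (\<sigma> i) \<omega> = \<kappa>' i} \<in> sets ?LN"
        proof (rule sets.sets_Collect_finite_All)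
          fix i assume "i \<in> {..<Suc n}"
          then have "0 \<le> \<sigma> i" "0 \<le> \<sigma> (Suc i)"
            using \<tau>0[of i] \<tau>0[of "Suc i"] t unfolding \<sigma>_def by auto
          note [measurable] = NLN[OF this(1)] NLN[OF this(2)]
          show "{\<omega> \<in> space ?LN. N (\<sigma> (Suc i)) \<omega> - N (\<sigma> i) \<omega> = \<kappa>' i} \<in> sets ?LN" by measurable
        qed simp
        then have [measurable]: "D' \<in> sets ?LN"
          unfolding D'_def by (simp only: lessThan_iff Ball_def space_sigma_join space_sigma_gen)
        show "(\<lambda>\<omega>. ?E \<omega> * indicator D' \<omega>) \<in> borel_measurable ?LN" by measurable
        let ?HU = "sigma_gen (space M) borel U {1..}"
        have [measurable]: "i \<in> {k<..k+m} \<Longrightarrow> U i \<in> borel_measurable ?HU" for i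
          by (intro measurable_sigma_gen) auto
        have [measurable]: "FU \<in> borel_measurable ?HU"
          by (rule measurable_sets_mono[OF FU _ sigma_gen_mono]) auto
        show "(\<lambda>\<omega>. FU \<omega> * ?P \<omega>) \<in> borel_measurable ?HU" by measurable
      qed simp_all
      also have "(\<integral>\<^sup>+\<omega>. FU \<omega> * ?P \<omega> \<partial>M) = (\<integral>\<^sup>+\<omega>. FU \<omega> \<partial>M) * (\<integral>\<^sup>+\<omega>. ?P \<omega> \<partial>M)"
      proof (rule nn_integral_indep_mult[OF _ _ _ FU])
        show "indep_set (sets (sigma_gen (space M) borel U {1..k})) (sets (sigma_gen (space M) borel U {k<..}))"
          using U_iid unfolding iid_seq_def by (intro indep_set_sigma_gen[where K="{1..}"]) auto
        have [measurable]: "i \<in> {k<..k+m} \<Longrightarrow> U i \<in> borel_measurable (sigma_gen (space M) borel U {k<..})" for i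
          by (intro measurable_sigma_gen) auto
        show "?P \<in> borel_measurable (sigma_gen (space M) borel U {k<..})" by measurable
      qed simp_all
      also have "(\<integral>\<^sup>+\<omega>. ?P \<omega> \<partial>M) = ?q ^ m"
        using nn_integral_prod_iid[OF U_iid, of "\<lambda>y. ennreal (exp (r * y))" "{k<..k+m}"]
        by (simp add: nn_integral_exp_eq_mgf[OF exp_U] subset_eq)
      also have "(\<integral>\<^sup>+\<omega>. ?E \<omega> * indicator D' \<omega> \<partial>M) = (\<integral>\<^sup>+\<omega>. ?E \<omega> * (\<Prod>i<Suc n.
          ennreal (poisson_weight (LBINT v:{\<sigma> i..\<sigma> (Suc i)}. L v \<omega>) (\<kappa>' i))) \<partial>M)"
        unfolding D'_def
      proof (rule nn_integral_N_increments)
        let ?HL = "sigma_gen (space M) borel L {0..}"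
        have [measurable]: "L t \<in> borel_measurable ?HL" using t by (intro measurable_sigma_gen) auto
        have "sets (sigma_gen (space M) borel L {0..s}) \<subseteq> sets ?HL" by (rule sigma_gen_mono) auto
        then have [measurable]: "a \<in> sets ?HL" using a by auto
        show "?E \<in> borel_measurable ?HL" by measurable
      qed (use \<sigma> in auto)
      also have "\<dots> = (\<integral>\<^sup>+\<omega>. ?E \<omega> * (\<Phi> \<omega> * ennreal (poisson_weight (?\<mu> s t \<omega>) m)) \<partial>M)"
      proof (rule nn_integral_cong)
        fix \<omega> assume \<omega>: "\<omega> \<in> space M"
        have "(\<Prod>i<n. ennreal (poisson_weight (LBINT v:{\<sigma> i..\<sigma> (Suc i)}. L v \<omega>) (\<kappa>' i))) = \<Phi> \<omega>"
          unfolding \<Phi>_def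
        proof (rule prod.cong[OF refl])
          fix i assume i: "i \<in> {..<n}"
          then have "\<sigma> i = \<tau> i" "\<sigma> (Suc i) = \<tau> (Suc i)" "\<kappa>' i = \<kappa> i" unfolding \<sigma>_def \<kappa>'_def by auto
          moreover have "(LBINT v:{\<tau> i..\<tau> (Suc i)}. L v \<omega>) = ?\<mu> (\<tau> i) (\<tau> (Suc i)) \<omega>"
            using i \<tau>0[of i] \<tau>(2) by (intro integral_L[OF \<omega>]) auto
          ultimately show "ennreal (poisson_weight (LBINT v:{\<sigma> i..\<sigma> (Suc i)}. L v \<omega>) (\<kappa>' i))
            = ennreal (poisson_weight (?\<mu> (\<tau> i) (\<tau> (Suc i)) \<omega>) (\<kappa> i))" by simp
        qed
        moreover have "\<sigma> n = s" "\<sigma> (Suc n) = t" "\<kappa>' n = m" using \<tau>(3) unfolding \<sigma>_def \<kappa>'_def by auto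
        moreover have "(LBINT v:{s..t}. L v \<omega>) = ?\<mu> s t \<omega>" by (rule integral_L[OF \<omega> s st])
        ultimately show "?E \<omega> * (\<Prod>i<Suc n. ennreal (poisson_weight (LBINT v:{\<sigma> i..\<sigma> (Suc i)}. L v \<omega>) (\<kappa>' i)))
          = ?E \<omega> * (\<Phi> \<omega> * ennreal (poisson_weight (?\<mu> s t \<omega>) m))" by simp
      qed
      finally have "(\<integral>\<^sup>+\<omega>. ennreal (tilt t \<omega>) * indicator {k} (N s \<omega>) * indicator (D \<inter> a \<inter> b) \<omega>
          * indicator {m} (N t \<omega> - N s \<omega>) \<partial>M)
        = ?C t * (\<integral>\<^sup>+\<omega>. FU \<omega> \<partial>M) *
          ((\<integral>\<^sup>+\<omega>. ?E \<omega> * (\<Phi> \<omega> * ennreal (poisson_weight (?\<mu> s t \<omega>) m)) \<partial>M) * ?q ^ m)"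
        by (simp add: mult_ac)
      also have "(\<integral>\<^sup>+\<omega>. ?E \<omega> * (\<Phi> \<omega> * ennreal (poisson_weight (?\<mu> s t \<omega>) m)) \<partial>M) * ?q ^ m
        = (\<integral>\<^sup>+\<omega>. ?E \<omega> * (\<Phi> \<omega> * ennreal (poisson_weight (?\<mu> s t \<omega>) m)) * ?q ^ m \<partial>M)"
        by (rule nn_integral_multc[symmetric]) measurable
      finally show ?thesis by (simp add: mult_ac)
    qed
    have "(\<integral>\<^sup>+\<omega>. ennreal (tilt t \<omega>) * indicator {k} (N s \<omega>) * indicator (D \<inter> a \<inter> b) \<omega> \<partial>M)
      = (\<Sum>m. \<integral>\<^sup>+\<omega>. ennreal (tilt t \<omega>) * indicator {k} (N s \<omega>) * indicator (D \<inter> a \<inter> b) \<omega>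
          * indicator {m} (N t \<omega> - N s \<omega>) \<partial>M)"
      by (rule nn_integral_split_nat[OF _ Nts]) measurable
    also have "\<dots> = ?C t * (\<integral>\<^sup>+\<omega>. FU \<omega> \<partial>M) *
        (\<Sum>m. \<integral>\<^sup>+\<omega>. ?E \<omega> * \<Phi> \<omega> * (ennreal (poisson_weight (?\<mu> s t \<omega>) m) * ?q ^ m) \<partial>M)"
      by (simp only: piece ennreal_suminf_cmult)
    also have "(\<Sum>m. \<integral>\<^sup>+\<omega>. ?E \<omega> * \<Phi> \<omega> * (ennreal (poisson_weight (?\<mu> s t \<omega>) m) * ?q ^ m) \<partial>M)
      = (\<integral>\<^sup>+\<omega>. (\<Sum>m. ?E \<omega> * \<Phi> \<omega> * (ennreal (poisson_weight (?\<mu> s t \<omega>) m) * ?q ^ m)) \<partial>M)"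
      by (rule nn_integral_suminf[symmetric]) measurable
    also have "\<dots> = (\<integral>\<^sup>+\<omega>. \<Psi> \<omega> * ennreal (exp (- \<alpha> * (J t \<omega> - J s \<omega>))) \<partial>M)"
    proof (rule nn_integral_cong_AE)
      show "AE \<omega> in M. (\<Sum>m. ?E \<omega> * \<Phi> \<omega> * (ennreal (poisson_weight (?\<mu> s t \<omega>) m) * ?q ^ m))
        = \<Psi> \<omega> * ennreal (exp (- \<alpha> * (J t \<omega> - J s \<omega>)))"
        using AE_Y_pos AE_space
      proof eventually_elim
        fix \<omega> assume Y: "\<forall>i\<ge>1. 0 < Y i \<omega>" and \<omega>: "\<omega> \<in> space M"
        (* The claims after s give exp ((M_U(r) - 1) \<mu>); by the path identity this replaces L t by L s at the cost of the
           increment of J. *)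
        have \<mu>: "0 \<le> ?\<mu> s t \<omega>"
          using integral_L_nonneg[OF Y, of s t] unfolding integral_L[OF \<omega> s st] .
        have "(\<Sum>m. ?E \<omega> * \<Phi> \<omega> * (ennreal (poisson_weight (?\<mu> s t \<omega>) m) * ?q ^ m))
          = ?E \<omega> * \<Phi> \<omega> * ennreal (exp ((mgf \<nu>U r - 1) * ?\<mu> s t \<omega>))"
          by (simp only: ennreal_suminf_cmult poisson_weight_pgf[OF \<mu> mgf_nonneg])
        also have "(mgf \<nu>U r - 1) * ?\<mu> s t \<omega> = - \<alpha> * (L s \<omega> - L t \<omega> + J t \<omega> - J s \<omega>)"
          unfolding alpha using delta_pos by (simp add: field_simps)
        also have "?E \<omega> * \<Phi> \<omega> * ennreal (exp (- \<alpha> * (L s \<omega> - L t \<omega> + J t \<omega> - J s \<omega>)))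
          = (ennreal (exp (- \<alpha> * L t \<omega>)) * ennreal (exp (- \<alpha> * (L s \<omega> - L t \<omega> + J t \<omega> - J s \<omega>))))
            * indicator a \<omega> * \<Phi> \<omega>"
          by (simp only: mult_ac)
        also have "ennreal (exp (- \<alpha> * L t \<omega>)) * ennreal (exp (- \<alpha> * (L s \<omega> - L t \<omega> + J t \<omega> - J s \<omega>)))
          = ennreal (exp (- \<alpha> * L s \<omega>)) * ennreal (exp (- \<alpha> * (J t \<omega> - J s \<omega>)))"
          by (simp add: ennreal_mult''[symmetric] exp_add[symmetric] algebra_simps)
        finally show "(\<Sum>m. ?E \<omega> * \<Phi> \<omega> * (ennreal (poisson_weight (?\<mu> s t \<omega>) m) * ?q ^ m))
          = \<Psi> \<omega> * ennreal (exp (- \<alpha> * (J t \<omega> - J s \<omega>)))"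
          by (simp only: \<Psi>_def mult_ac)
      qed
    qed
    also have "\<dots> = (\<integral>\<^sup>+\<omega>. \<Psi> \<omega> \<partial>M) * ennreal (exp ((mgf \<nu>Y (- \<alpha>) - 1) * (\<rho> * (t - s))))"
      by (rule nn_integral_J_increment[OF s st \<Psi>_past exp_Y])
    finally have "(\<integral>\<^sup>+\<omega>. ennreal (tilt t \<omega>) * indicator {k} (N s \<omega>) * indicator (D \<inter> a \<inter> b) \<omega> \<partial>M)
      = (?C t * ennreal (exp ((mgf \<nu>Y (- \<alpha>) - 1) * (\<rho> * (t - s))))) * ((\<integral>\<^sup>+\<omega>. FU \<omega> \<partial>M) * (\<integral>\<^sup>+\<omega>. \<Psi> \<omega> \<partial>M))"
      by (simp add: mult_ac)
    (* This is where the value of \<theta> enters. *)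
    also have "?C t * ennreal (exp ((mgf \<nu>Y (- \<alpha>) - 1) * (\<rho> * (t - s)))) = ?C s"
      by (simp add: ennreal_mult''[symmetric] exp_add[symmetric] theta algebra_simps)
    finally show "(\<integral>\<^sup>+\<omega>. ennreal (tilt t \<omega>) * indicator {k} (N s \<omega>) * indicator (D \<inter> a \<inter> b) \<omega> \<partial>M)
      = ?C s * ((\<integral>\<^sup>+\<omega>. FU \<omega> \<partial>M) * (\<integral>\<^sup>+\<omega>. \<Psi> \<omega> \<partial>M))" .
  qed
qed

text \<open>Apply the preceding lemma with \<open>s = 0\<close> to the sure event: the expectation does not depend on time, and at time
  \<open>0\<close> the process equals \<open>1\<close>.\<close>

lemma nn_integral_tilt:
  assumes t: "0 \<le> t"
  shows "(\<integral>\<^sup>+\<omega>. ennreal (tilt t \<omega>) \<partial>M) = 1"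
proof -
  have N0: "N 0 \<omega> = 0" and NL0: "NL 0 \<omega> = 0" if "\<omega> \<in> space M" for \<omega>
    using that N_counting NL_counting unfolding counting_process_def by auto
  obtain V where V: "\<And>t. 0 \<le> t \<Longrightarrow>
    (\<integral>\<^sup>+\<omega>. ennreal (tilt t \<omega>) * indicator {0} (N 0 \<omega>) * indicator (space M \<inter> space M \<inter> space M) \<omega> \<partial>M) = V"
  proof (rule nn_integral_tilt_cylinder[of 0 "space M" "space M" "space M" 0])
    show "space M \<in> sets (sigma_gen (space M) borel L {0..0})"
      using sets.top[of "sigma_gen (space M) borel L {0..0}"] by simp
    show "space M \<in> sets (sigma_gen (space M) borel U {1..0})"
      using sets.top[of "sigma_gen (space M) borel U {1..0}"] by simp
  qed (simp_all add: space_in_cylinders)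
  have V': "(\<integral>\<^sup>+\<omega>. ennreal (tilt t \<omega>) \<partial>M) = V" if "0 \<le> t" for t
    unfolding V[OF that, symmetric] by (intro nn_integral_cong) (simp add: N0)
  have "V = (\<integral>\<^sup>+\<omega>. 1 \<partial>M)"
    unfolding V'[of 0, simplified, symmetric]
    by (intro nn_integral_cong)
      (simp add: tilt_def surplus_def shot_noise_def N0 NL0 exp_add[symmetric] algebra_simps)
  then show ?thesis using V'[OF t] by (simp add: emeasure_space_1)
qed

text \<open>The martingale identity before augmentation. Dynkin's theorem is applied on each stratum
  \<open>N\<^sub>s = k\<close>, where the past has a generator of events \<open>D \<inter> a \<inter> b\<close>.\<close>

lemma nn_integral_tilt_surplus_past:
  assumes s: "0 \<le> s" and st: "s \<le> t" and A: "A \<in> sets (surplus_past s)"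
  shows "(\<integral>\<^sup>+\<omega>. ennreal (tilt t \<omega>) * indicator A \<omega> \<partial>M) = (\<integral>\<^sup>+\<omega>. ennreal (tilt s \<omega>) * indicator A \<omega> \<partial>M)"
proof -
  have t: "0 \<le> t" using s st by simp
  note [measurable] = tilt_measurable[OF s] tilt_measurable[OF t]
  have Ns: "N s \<in> measurable M (count_space UNIV)" by (rule N_measurable[OF s])
  have [measurable]: "(\<lambda>\<omega>. indicator {k} (N s \<omega>) :: ennreal) \<in> borel_measurable M" for k
    by (rule measurable_compose[OF Ns]) simp
  have [measurable]: "A \<in> sets M" using A sets_surplus_past_subset[OF s] by auto
  have "(\<integral>\<^sup>+\<omega>. ennreal (tilt t \<omega>) * indicator A \<omega> * indicator {k} (N s \<omega>) \<partial>M)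
      = (\<integral>\<^sup>+\<omega>. ennreal (tilt s \<omega>) * indicator A \<omega> * indicator {k} (N s \<omega>) \<partial>M)" for k
  proof -
    let ?N = "sigma_gen (space M) (count_space UNIV) N {0..s}"
    let ?L = "sigma_gen (space M) borel L {0..s}" and ?U = "sigma_gen (space M) borel U {1..k}"
    let ?C = "cylinders (space M) N {0..s}"
    define E where "E = {D \<inter> a \<inter> b | D a b. D \<in> ?C \<and> a \<in> sets ?L \<and> b \<in> sets ?U}"
    have EI: "D \<inter> a \<inter> b \<in> E" if "D \<in> ?C" "a \<in> sets ?L" "b \<in> sets ?U" for D a b
      using that unfolding E_def by blast
    have top: "space M \<in> ?C" "space M \<in> sets ?L" "space M \<in> sets ?U"
      using space_in_cylinders sets.top[of ?L] sets.top[of ?U] by auto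
    have C: "?C \<subseteq> sets M" by (rule cylinders_subset_events) (simp add: N_measurable)
    have LU: "sets ?L \<subseteq> sets M" "sets ?U \<subseteq> sets M"
      by (intro sets_sigma_gen_subset; simp add: L_measurable U_measurable)+
    have E: "E \<subseteq> sets M"
      unfolding E_def using C LU by (auto intro!: sets.Int)
    have stable: "Int_stable E"
    proof (rule Int_stableI)
      fix p q assume "p \<in> E" "q \<in> E"
      then obtain D a b D' a' b' where eq: "p = D \<inter> a \<inter> b" "q = D' \<inter> a' \<inter> b'"
        and m: "D \<in> ?C" "a \<in> sets ?L" "b \<in> sets ?U" "D' \<in> ?C" "a' \<in> sets ?L" "b' \<in> sets ?U"
        unfolding E_def by blast
      have "p \<inter> q = (D \<inter> D') \<inter> (a \<inter> a') \<inter> (b \<inter> b')" unfolding eq by blast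
      also have "\<dots> \<in> E"
        using m by (intro EI Int_stableD[OF Int_stable_cylinders] sets.Int)
      finally show "p \<inter> q \<in> E" .
    qed
    have topE: "space M \<in> E" using EI[OF top] by simp
    have E_Pow: "E \<subseteq> Pow (space M)" using E sets.space_closed by auto
    have "sets (claim_past s k) \<subseteq> sets (sigma (space M) E)"
      unfolding claim_past_def
    proof (intro sets_sigma_join_least)
      have "?C \<subseteq> E"
      proof
        fix D assume D: "D \<in> ?C"
        then have "D \<inter> space M \<inter> space M = D" using C sets.sets_into_space by blast
        with EI[OF D top(2,3)] show "D \<in> E" by simp
      qed
      then show "sets ?N \<subseteq> sets (sigma (space M) E)"
        using sets_sigma_gen_cylinders[of "space M" N "{0..s}"] sigma_sets_mono'[of ?C E "space M"] E_Pow by simp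
      have "sets ?L \<subseteq> E"
      proof
        fix D assume D: "D \<in> sets ?L"
        then have "space M \<inter> D \<inter> space M = D" using sets.sets_into_space[OF D] by auto
        with EI[OF top(1) D top(3)] show "D \<in> E" by simp
      qed
      then show "sets ?L \<subseteq> sets (sigma (space M) E)" using E_Pow by (auto intro: sigma_sets.Basic)
      have "sets ?U \<subseteq> E"
      proof
        fix D assume D: "D \<in> sets ?U"
        then have "space M \<inter> space M \<inter> D = D" using sets.sets_into_space[OF D] by auto
        with EI[OF top(1,2) D] show "D \<in> E" by simp
      qed
      then show "sets ?U \<subseteq> sets (sigma (space M) E)" using E_Pow by (auto intro: sigma_sets.Basic)
    qed (use E_Pow in \<open>simp_all add: space_measure_of\<close>)
    moreover have "A \<inter> {\<omega>. N s \<omega> = k} \<in> sets (claim_past s k)"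
      using A unfolding surplus_past_def sets_stratified[OF space_claim_past stratum_claim_past[OF s]] by auto
    ultimately have Ak: "A \<inter> {\<omega>. N s \<omega> = k} \<in> sigma_sets (space M) E"
      using E_Pow by auto
    have fin: "(\<integral>\<^sup>+\<omega>. ennreal (tilt t \<omega>) * indicator {k} (N s \<omega>) \<partial>M) \<noteq> \<infinity>"
    proof -
      have "(\<integral>\<^sup>+\<omega>. ennreal (tilt t \<omega>) * indicator {k} (N s \<omega>) \<partial>M) \<le> (\<integral>\<^sup>+\<omega>. ennreal (tilt t \<omega>) \<partial>M)"
        by (intro nn_integral_mono) (auto simp: indicator_def)
      also have "\<dots> = 1" by (rule nn_integral_tilt[OF t])
      finally show ?thesis by (auto simp: top_unique)
    qed
    have "(\<integral>\<^sup>+\<omega>. ennreal (tilt t \<omega>) * indicator {k} (N s \<omega>) * indicator (A \<inter> {\<omega>. N s \<omega> = k}) \<omega> \<partial>M)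
      = (\<integral>\<^sup>+\<omega>. ennreal (tilt s \<omega>) * indicator {k} (N s \<omega>) * indicator (A \<inter> {\<omega>. N s \<omega> = k}) \<omega> \<partial>M)"
    proof (rule nn_integral_eq_on_generated[OF stable E topE _ _ fin _ Ak])
      fix B assume "B \<in> E"
      then obtain D a b where B: "B = D \<inter> a \<inter> b" "D \<in> ?C" "a \<in> sets ?L" "b \<in> sets ?U"
        unfolding E_def by blast
      obtain V where "\<And>t. s \<le> t \<Longrightarrow>
        (\<integral>\<^sup>+\<omega>. ennreal (tilt t \<omega>) * indicator {k} (N s \<omega>) * indicator (D \<inter> a \<inter> b) \<omega> \<partial>M) = V"
        by (rule nn_integral_tilt_cylinder[OF s B(2-4)]) blast
      from this[OF st] this[OF order_refl]
      show "(\<integral>\<^sup>+\<omega>. ennreal (tilt t \<omega>) * indicator {k} (N s \<omega>) * indicator B \<omega> \<partial>M)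
        = (\<integral>\<^sup>+\<omega>. ennreal (tilt s \<omega>) * indicator {k} (N s \<omega>) * indicator B \<omega> \<partial>M)"
        unfolding B(1) by simp
    qed measurable
    moreover have "ennreal (tilt v \<omega>) * indicator {k} (N s \<omega>) * indicator (A \<inter> {\<omega>. N s \<omega> = k}) \<omega>
      = ennreal (tilt v \<omega>) * indicator A \<omega> * indicator {k} (N s \<omega>)" for v \<omega>
      by (auto simp: indicator_def)
    ultimately show ?thesis by simp
  qed
  then show ?thesis
    using nn_integral_split_nat[OF _ Ns, of "\<lambda>\<omega>. ennreal (tilt t \<omega>) * indicator A \<omega>"]
      nn_integral_split_nat[OF _ Ns, of "\<lambda>\<omega>. ennreal (tilt s \<omega>) * indicator A \<omega>"]
    by simp
qed

lemma integrable_tilt: "0 \<le> t \<Longrightarrow> integrable M (tilt t)"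
  using nn_integral_tilt[of t] tilt_measurable[of t] tilt_nonneg[of t]
  by (intro integrableI_nonneg) auto

lemma integral_tilt: "0 \<le> t \<Longrightarrow> (\<integral>\<omega>. tilt t \<omega> \<partial>M) = 1"
  using nn_integral_tilt[of t] tilt_measurable[of t] tilt_nonneg[of t]
  by (subst integral_eq_nn_integral) auto

text \<open>Immediately after \<open>s\<close> there is neither a claim nor a shock, so the process follows a continuous
  expression.\<close>

lemma tilt_right_continuous:
  assumes \<omega>: "\<omega> \<in> space M" and s: "0 \<le> s"
  shows "((\<lambda>v. tilt v \<omega>) \<longlongrightarrow> tilt s \<omega>) (at_right s)"
proof -
  let ?L = "\<lambda>v. lam0 * exp (- \<delta> * v) + (\<Sum>i=1..NL s \<omega>. Y i \<omega> * exp (- \<delta> * (v - jump_time NL i \<omega>)))"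
  let ?X = "\<lambda>v. u + c * v - (\<Sum>i=1..N s \<omega>. U i \<omega>)"
  let ?f = "\<lambda>v. exp (r * u + \<alpha> * lam0) * exp (- \<theta> * v - \<alpha> * ?L v - r * ?X v)"
  have lim: "(?f \<longlongrightarrow> ?f s) (at_right s)"
    by (intro tendsto_intros)
  have ev: "\<forall>\<^sub>F v in at_right s. ?f v = tilt v \<omega>"
    using counting_process_locally_constant[OF N_counting \<omega> s] counting_process_locally_constant[OF NL_counting \<omega> s]
    by eventually_elim (simp add: tilt_def shot_noise_def surplus_def)
  have fs: "?f s = tilt s \<omega>" by (simp add: tilt_def shot_noise_def surplus_def)
  show ?thesis
    using Lim_transform_eventually[OF lim ev] unfolding fs .
qed

end

section \<open>Augmented filtrations\<close>

text \<open>The \<open>\<sigma>\<close>-algebras whose intersection over \<open>v > t\<close> is the augmented filtration at \<open>t\<close>.\<close>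

abbreviation completed_history :: "'a measure \<Rightarrow> (real \<Rightarrow> 'a \<Rightarrow> real) \<Rightarrow> real \<Rightarrow> 'a set set" where
  "completed_history M Z v \<equiv>
     sigma_sets (space M) (sets (generated_sigma M {0..v} Z) \<union> null_sets (completion M))"

lemma completed_history_generator_Pow:
  "sets (generated_sigma M {0..v} Z) \<union> null_sets (completion M) \<subseteq> Pow (space M)"
  using sets.space_closed[of "generated_sigma M {0..v} Z"] sets.space_closed[of "completion M"]
  by (auto simp: generated_sigma_eq_sigma_gen)

lemma Inter_completed_history_Pow: "(\<Inter>v\<in>{t<..}. completed_history M Z v) \<subseteq> Pow (space M)"
proof -
  have "(\<Inter>v\<in>{t<..}. completed_history M Z v) \<subseteq> completed_history M Z (t + 1)"
    by (rule INF_lower) simp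
  also have "\<dots> \<subseteq> Pow (space M)"
    using sigma_sets_into_sp[OF completed_history_generator_Pow] by blast
  finally show ?thesis .
qed

lemma space_augmented_filtration [simp]: "space (augmented_filtration M Z t) = space M"
  unfolding augmented_filtration_def by (rule space_measure_of[OF Inter_completed_history_Pow])

lemma sets_augmented_filtration:
  "sets (augmented_filtration M Z t) = sigma_sets (space M) (\<Inter>v\<in>{t<..}. completed_history M Z v)"
  unfolding augmented_filtration_def by (rule sets_measure_of[OF Inter_completed_history_Pow])

lemma sets_augmented_filtration_subset:
  assumes "t < v"
  shows "sets (augmented_filtration M Z t) \<subseteq> completed_history M Z v"
  unfolding sets_augmented_filtration
proof (rule sigma_algebra.sigma_sets_subset[OF sigma_algebra_sigma_sets[OF completed_history_generator_Pow]])
  show "(\<Inter>v\<in>{t<..}. completed_history M Z v) \<subseteq> completed_history M Z v"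
    by (rule INF_lower) (simp add: assms)
qed

lemma augmented_filtration_mono:
  "s \<le> t \<Longrightarrow> sets (augmented_filtration M Z s) \<subseteq> sets (augmented_filtration M Z t)"
  unfolding sets_augmented_filtration by (intro sigma_sets_mono' INF_superset_mono) auto

lemma measurable_augmented_filtration:
  assumes "0 \<le> t"
  shows "Z t \<in> borel_measurable (augmented_filtration M Z t)"
proof (rule measurableI)
  fix A :: "real set" assume A: "A \<in> sets borel"
  have "Z t -` A \<inter> space M \<in> sets (generated_sigma M {0..v} Z)" if "t < v" for v
    using measurable_sets[OF measurable_sigma_gen[of t "{0..v}" Z "space M" borel], of A] assms that A
    by (simp add: generated_sigma_eq_sigma_gen)
  then show "Z t -` A \<inter> space (augmented_filtration M Z t) \<in> sets (augmented_filtration M Z t)"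
    unfolding sets_augmented_filtration space_augmented_filtration
    by (intro sigma_sets.Basic INT_I) (auto intro: sigma_sets.Basic)
qed simp

text \<open>Adjoining null sets does not create new events up to almost sure equality.\<close>

lemma completed_event_AE_eq:
  assumes sp: "space G = space M" and sub: "sets G \<subseteq> sets M"
    and A: "A \<in> sigma_sets (space M) (sets G \<union> null_sets (completion M))"
  shows "\<exists>B\<in>sets G. AE \<omega> in M. \<omega> \<in> A \<longleftrightarrow> \<omega> \<in> B"
  using A
proof induction
  case (Basic A)
  show ?case
  proof (cases "A \<in> sets G")
    case False
    then have "A \<in> null_sets (completion M)" using Basic by auto
    then have "AE \<omega> in M. \<omega> \<notin> A" using AE_not_in AE_completion_iff by blast
    then show ?thesis by (intro bexI[of _ "{}"]) auto
  qed auto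
next
  case (Compl A)
  then obtain B where B: "B \<in> sets G" "AE \<omega> in M. \<omega> \<in> A \<longleftrightarrow> \<omega> \<in> B" by auto
  have "AE \<omega> in M. \<omega> \<in> space M - A \<longleftrightarrow> \<omega> \<in> space G - B"
    using B(2) unfolding sp by eventually_elim auto
  then show ?case using B(1) by blast
next
  case (Union A)
  then obtain B where B: "\<And>i. B i \<in> sets G" "\<And>i::nat. AE \<omega> in M. \<omega> \<in> A i \<longleftrightarrow> \<omega> \<in> B i" by metis
  have "AE \<omega> in M. \<forall>i. \<omega> \<in> A i \<longleftrightarrow> \<omega> \<in> B i" using B(2) by (simp add: AE_all_countable)
  then have "AE \<omega> in M. \<omega> \<in> (\<Union>i. A i) \<longleftrightarrow> \<omega> \<in> (\<Union>i. B i)" by eventually_elim auto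
  moreover have "(\<Union>i. B i) \<in> sets G" using B(1) by auto
  ultimately show ?case by blast
qed auto

lemma sigma_sets_completion_subset:
  assumes "space G = space M" "sets G \<subseteq> sets M"
  shows "sigma_sets (space M) (sets G \<union> null_sets (completion M)) \<subseteq> sets (completion M)"
proof -
  have "sets G \<union> null_sets (completion M) \<subseteq> sets (completion M)"
    using assms(2) by auto
  from sets.sigma_sets_subset[OF this] show ?thesis by simp
qed

section \<open>The martingale property\<close>

context exponential_tilt
begin

abbreviation joint_filtration :: "real \<Rightarrow> 'a measure" where
  "joint_filtration \<equiv> join_filtration M (augmented_filtration M X) (augmented_filtration M L)"

lemma joint_filtration_eq:
  "joint_filtration t = sigma_join (augmented_filtration M X t) (augmented_filtration M L t)"
  by (simp add: join_filtration_def sigma_join_def)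

lemma space_joint_filtration: "space (joint_filtration t) = space M"
  by (simp add: joint_filtration_eq)

text \<open>Both augmented filtrations look infinitesimally beyond \<open>t\<close>, hence the strict
  inequality \<open>t < v\<close>.\<close>

lemma sets_joint_filtration_subset:
  assumes t: "0 \<le> t" "t < v"
  shows "sets (joint_filtration t) \<subseteq> sigma_sets (space M) (sets (surplus_past v) \<union> null_sets (completion M))"
proof -
  let ?S = "sigma_sets (space M) (sets (surplus_past v) \<union> null_sets (completion M))"
  have pow: "sets (surplus_past v) \<union> null_sets (completion M) \<subseteq> Pow (space M)"
    using sets.space_closed[of "surplus_past v"] sets.space_closed[of "completion M"] by auto
  have "sets (augmented_filtration M Z t) \<subseteq> ?S"
    if Z: "\<And>w. 0 \<le> w \<Longrightarrow> w \<le> v \<Longrightarrow> Z w \<in> borel_measurable (surplus_past v)" for Z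
  proof -
    have "sets (generated_sigma M {0..v} Z) \<subseteq> sets (surplus_past v)"
      unfolding generated_sigma_eq_sigma_gen by (intro sets_sigma_gen_subset) (auto intro: Z)
    then have "sigma_sets (space M) (sets (generated_sigma M {0..v} Z) \<union> null_sets (completion M)) \<subseteq> ?S"
      by (intro sigma_sets_mono') auto
    then show ?thesis using sets_augmented_filtration_subset[OF t(2), of M Z] by blast
  qed
  then have "sets (augmented_filtration M X t) \<union> sets (augmented_filtration M L t) \<subseteq> ?S"
    using X_surplus_past L_surplus_past by simp
  then have "sigma_sets (space M) (sets (augmented_filtration M X t) \<union> sets (augmented_filtration M L t)) \<subseteq> ?S"
    by (rule sigma_algebra.sigma_sets_subset[OF sigma_algebra_sigma_sets[OF pow]])
  then show ?thesis by (simp add: joint_filtration_eq sets_sigma_join)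
qed

lemma subalgebra_joint_filtration:
  assumes t: "0 \<le> t" shows "subalgebra (completion M) (joint_filtration t)"
  unfolding subalgebra_def
proof (intro conjI)
  show "space (joint_filtration t) = space (completion M)" by (simp add: space_joint_filtration)
  have "sets (surplus_past (t + 1)) \<subseteq> sets M" using t by (intro sets_surplus_past_subset) simp
  then show "sets (joint_filtration t) \<subseteq> sets (completion M)"
    using sets_joint_filtration_subset[OF t, of "t + 1"] sigma_sets_completion_subset[of "surplus_past (t + 1)" M]
    by auto
qed

lemma tilt_joint_filtration:
  assumes t: "0 \<le> t" shows "tilt t \<in> borel_measurable (joint_filtration t)"
proof -
  have [measurable]: "X t \<in> borel_measurable (joint_filtration t)"
    unfolding joint_filtration_eq
    by (rule measurable_sets_mono[OF measurable_augmented_filtration[OF t] _ sets_sigma_join_upper(1)]) simp_all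
  have [measurable]: "L t \<in> borel_measurable (joint_filtration t)"
    unfolding joint_filtration_eq
    by (rule measurable_sets_mono[OF measurable_augmented_filtration[OF t] _ sets_sigma_join_upper(2)]) simp_all
  show ?thesis unfolding tilt_def[abs_def] by measurable
qed

lemma nn_integral_tilt_joint_filtration:
  assumes "0 \<le> s" "s < v" "v \<le> t" and A: "A \<in> sets (joint_filtration s)"
  shows "(\<integral>\<^sup>+\<omega>. ennreal (tilt t \<omega>) * indicator A \<omega> \<partial>M) = (\<integral>\<^sup>+\<omega>. ennreal (tilt v \<omega>) * indicator A \<omega> \<partial>M)"
proof -
  have v: "0 \<le> v" using assms by simp
  have "A \<in> sigma_sets (space M) (sets (surplus_past v) \<union> null_sets (completion M))"
    using sets_joint_filtration_subset[OF assms(1,2)] A by auto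
  then obtain B where B: "B \<in> sets (surplus_past v)" "AE \<omega> in M. \<omega> \<in> A \<longleftrightarrow> \<omega> \<in> B"
    using completed_event_AE_eq[of "surplus_past v" M A] sets_surplus_past_subset[OF v] by auto
  have "(\<integral>\<^sup>+\<omega>. ennreal (tilt w \<omega>) * indicator A \<omega> \<partial>M) = (\<integral>\<^sup>+\<omega>. ennreal (tilt w \<omega>) * indicator B \<omega> \<partial>M)" for w
    using B(2) by (intro nn_integral_cong_AE) (auto elim!: AE_mp simp: indicator_def)
  then show ?thesis using nn_integral_tilt_surplus_past[OF v assms(3) B(1)] by simp
qed

text \<open>An event of the filtration at \<open>s\<close> is only known to belong to the completed past at times \<open>v > s\<close>, so the
  identity is obtained for \<open>v\<close> and then passed to the limit \<open>v \<rightarrow> s\<close> with Scheffe's lemma.\<close>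

lemma set_integral_tilt:
  assumes s: "0 \<le> s" "s \<le> t" and A: "A \<in> sets (joint_filtration s)"
  shows "(\<integral>\<omega>\<in>A. tilt t \<omega> \<partial>completion M) = (\<integral>\<omega>\<in>A. tilt s \<omega> \<partial>completion M)"
proof (cases "s = t")
  case False
  then have st: "s < t" using s by simp
  (* Any sequence in the half-open interval from s to t decreasing to s would do. *)
  define v where "v n = s + (t - s) / real (Suc n)" for n
  have v: "s < v n" "v n \<le> t" "0 \<le> v n" for n
  proof -
    have "(t - s) / real (Suc n) \<le> (t - s) / 1" using st by (intro divide_left_mono) auto
    then show "v n \<le> t" unfolding v_def by simp
    show "s < v n" unfolding v_def using st by simp
    then show "0 \<le> v n" using s by simp
  qed
  have "(\<lambda>n. (t - s) * (1 / real (Suc n))) \<longlonglongrightarrow> (t - s) * 0"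
    by (intro tendsto_intros LIMSEQ_Suc[OF lim_1_over_n])
  then have "(\<lambda>n. s + (t - s) / real (Suc n)) \<longlonglongrightarrow> s + 0"
    by (intro tendsto_intros) simp
  then have "v \<longlonglongrightarrow> s" by (simp add: v_def[abs_def])
  then have v_right: "filterlim v (at_right s) sequentially"
    by (rule tendsto_imp_filterlim_at_right) (simp add: v)
  let ?C = "completion M"
  have A': "A \<in> sets ?C" using A subalgebra_joint_filtration[OF s(1)] unfolding subalgebra_def by auto
  have meas: "tilt w \<in> borel_measurable ?C" if "0 \<le> w" for w
    using tilt_measurable[OF that] by (rule measurable_completion)
  have int: "integrable ?C (tilt w)" if "0 \<le> w" for w
    using integrable_tilt[OF that] tilt_measurable[OF that] by (simp add: integrable_completion)
  have "(\<lambda>n. \<integral>\<^sup>+\<omega>. norm (tilt (v n) \<omega> - tilt s \<omega>) \<partial>?C) \<longlonglongrightarrow> 0"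
  proof (rule Scheffe_lemma2)
    show "AE \<omega> in ?C. (\<lambda>n. tilt (v n) \<omega>) \<longlonglongrightarrow> tilt s \<omega>"
      using tilt_right_continuous[OF _ s(1)] filterlim_compose[OF _ v_right] by (intro AE_I2) auto
    show "(\<integral>\<^sup>+\<omega>. norm (tilt (v n) \<omega>) \<partial>?C) \<le> (\<integral>\<^sup>+\<omega>. norm (tilt s \<omega>) \<partial>?C)" for n
      using nn_integral_tilt[OF v(3)] nn_integral_tilt[OF s(1)]
      by (simp add: tilt_nonneg nn_integral_completion)
  qed (use v meas int s in auto)
  then have "(\<lambda>n. \<integral>\<^sup>+\<omega>. norm (indicator A \<omega> *\<^sub>R tilt (v n) \<omega> - indicator A \<omega> *\<^sub>R tilt s \<omega>) \<partial>?C) \<longlonglongrightarrow> 0"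
  proof (rule tendsto_sandwich[OF _ _ tendsto_const, rotated 2])
    show "\<forall>\<^sub>F n in sequentially. (\<integral>\<^sup>+\<omega>. norm (indicator A \<omega> *\<^sub>R tilt (v n) \<omega> - indicator A \<omega> *\<^sub>R tilt s \<omega>) \<partial>?C)
       \<le> (\<integral>\<^sup>+\<omega>. norm (tilt (v n) \<omega> - tilt s \<omega>) \<partial>?C)"
      by (intro always_eventually allI nn_integral_mono) (auto simp: indicator_def)
  qed simp
  then have "(\<lambda>n. \<integral>\<omega>. indicator A \<omega> *\<^sub>R tilt (v n) \<omega> \<partial>?C) \<longlonglongrightarrow> (\<integral>\<omega>. indicator A \<omega> *\<^sub>R tilt s \<omega> \<partial>?C)"
    using int v s A' by (intro tendsto_L1_int integrable_mult_indicator) auto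
  moreover have "(\<integral>\<omega>. indicator A \<omega> *\<^sub>R tilt (v n) \<omega> \<partial>?C) = (\<integral>\<omega>. indicator A \<omega> *\<^sub>R tilt t \<omega> \<partial>?C)" for n
  proof -
    have eq: "(\<integral>\<omega>. indicator A \<omega> *\<^sub>R tilt w \<omega> \<partial>?C) = enn2real (\<integral>\<^sup>+\<omega>. ennreal (tilt w \<omega>) * indicator A \<omega> \<partial>M)"
      if "0 \<le> w" for w
    proof -
      have "(\<integral>\<omega>. indicator A \<omega> *\<^sub>R tilt w \<omega> \<partial>?C) = enn2real (\<integral>\<^sup>+\<omega>. ennreal (indicator A \<omega> *\<^sub>R tilt w \<omega>) \<partial>?C)"
        using meas[OF that] A' tilt_nonneg by (intro integral_eq_nn_integral) auto
      also have "(\<integral>\<^sup>+\<omega>. ennreal (indicator A \<omega> *\<^sub>R tilt w \<omega>) \<partial>?C) = (\<integral>\<^sup>+\<omega>. ennreal (tilt w \<omega>) * indicator A \<omega> \<partial>M)"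
        unfolding nn_integral_completion by (intro nn_integral_cong) (simp add: indicator_def)
      finally show ?thesis .
    qed
    show ?thesis
      using eq[of t] eq[of "v n"] nn_integral_tilt_joint_filtration[OF s(1) v(1,2) A] v(3)[of n] s by simp
  qed
  ultimately have "(\<lambda>n::nat. \<integral>\<omega>. indicator A \<omega> *\<^sub>R tilt t \<omega> \<partial>?C) \<longlonglongrightarrow> (\<integral>\<omega>. indicator A \<omega> *\<^sub>R tilt s \<omega> \<partial>?C)"
    by simp
  then show ?thesis
    unfolding set_lebesgue_integral_def by (simp add: LIMSEQ_const_iff)
qed simp

theorem martingale_tilt: "martingale (completion M) joint_filtration tilt"
  unfolding martingale_def
proof (intro conjI allI impI)
  interpret C: prob_space "completion M" by (rule prob_space_completion)
  fix t :: real assume t: "0 \<le> t"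
  show "subalgebra (completion M) (joint_filtration t)" by (rule subalgebra_joint_filtration[OF t])
  show "tilt t \<in> borel_measurable (joint_filtration t)" by (rule tilt_joint_filtration[OF t])
  show int: "integrable (completion M) (tilt t)"
    using integrable_tilt[OF t] tilt_measurable[OF t] by (simp add: integrable_completion)
next
  fix s t :: real assume st: "0 \<le> s" "s \<le> t"
  have "sets (augmented_filtration M X s) \<union> sets (augmented_filtration M L s)
    \<subseteq> sets (augmented_filtration M X t) \<union> sets (augmented_filtration M L t)"
    using augmented_filtration_mono[OF st(2), of M X] augmented_filtration_mono[OF st(2), of M L] by auto
  from sigma_sets_mono'[OF this, of "space M"]
  show "sets (joint_filtration s) \<subseteq> sets (joint_filtration t)"
    by (simp add: joint_filtration_eq sets_sigma_join)
  interpret C: prob_space "completion M" by (rule prob_space_completion)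
  interpret F: finite_measure_subalgebra "completion M" "joint_filtration s"
    using subalgebra_joint_filtration[OF st(1)] by unfold_locales
  have int: "integrable (completion M) (tilt w)" if "0 \<le> w" for w
    using integrable_tilt[OF that] tilt_measurable[OF that] by (simp add: integrable_completion)
  show "AE \<omega> in completion M. real_cond_exp (completion M) (joint_filtration s) (tilt t) \<omega> = tilt s \<omega>"
    using set_integral_tilt[OF st] st
    by (intro F.real_cond_exp_charact int tilt_joint_filtration) auto
qed

end

theorem theorem3p4:
  fixes M :: "'a measure"
    and \<rho> \<delta> c u lam0 :: real
    and NL N :: "real \<Rightarrow> 'a \<Rightarrow> nat" and Y U :: "nat \<Rightarrow> 'a \<Rightarrow> real" and \<nu>Y \<nu>U :: "real measure"
    and L X Mr :: "real \<Rightarrow> 'a \<Rightarrow> real" and F :: "real \<Rightarrow> 'a measure"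
    and r \<alpha> \<theta> \<beta> :: real and h :: "real \<Rightarrow> real \<Rightarrow> real \<Rightarrow> real"
  assumes model: "shot_noise_risk_model M \<rho> \<delta> c u lam0 NL Y \<nu>Y N U \<nu>U"
    and L: "L = shot_noise \<delta> lam0 NL Y"
    and X: "X = surplus c u N U"
    and F: "F = join_filtration M (augmented_filtration M X) (augmented_filtration M L)"
    and MU_finite: "integrable \<nu>U (\<lambda>x. exp (r * x))"
    and alpha: "\<alpha> = (1 - mgf \<nu>U r) / \<delta>"
    and MY_finite: "integrable \<nu>Y (\<lambda>y. exp (- \<alpha> * y))"
    and Y_exp_finite: "integrable \<nu>Y (\<lambda>y. y * exp (- \<alpha> * y))"
    and theta: "\<theta> = - c * r + \<rho> * (mgf \<nu>Y (- \<alpha>) - 1)"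
    and beta: "\<beta> = exp (r * u + \<alpha> * lam0)"
    and h: "\<And>x l t. h x l t = \<beta> * exp (- \<theta> * t - \<alpha> * l - r * x)"
    and Mr: "\<And>t \<omega>. Mr t \<omega> = h (X t \<omega>) (L t \<omega>) t"
  shows "martingale (completion M) F Mr \<and> (\<forall>t\<ge>0. (\<integral>\<omega>. Mr t \<omega> \<partial>M) = 1)"
proof -
  interpret shot_noise_risk_model M \<rho> \<delta> c u lam0 NL Y \<nu>Y N U \<nu>U by (rule model)
  interpret exponential_tilt M \<rho> \<delta> c u lam0 NL Y \<nu>Y N U \<nu>U r \<alpha> \<theta>
    by unfold_locales (fact MU_finite alpha MY_finite theta)+
  have "Mr = tilt"
    by (intro ext) (simp add: Mr h beta tilt_def L X)
  then show ?thesis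
    using martingale_tilt integral_tilt by (simp add: F L X)
qed

end
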